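(* Let $V>0$, let $\mathcal{D}$ be a known centered sub-exponential distribution on $\mathbb{R}$, and let the data be generated by the uncoupled isotonic regression model (described in the context) with $n$ observations, regression function $f\in\mathcal{F}_V$ and noise distribution $\mathcal{D}$. There exist an estimator $\hat f_n$ (a measurable function of the uncoupled data, which may depend on the known $V$ and $\mathcal{D}$, but not on $p$) and a universal constant $C$ such that, for all $1\le p<\infty$, $$\sup_{f\in\mathcal{F}_V}\big(\mathbb{E}\|f-\hat f_n\|_p^p\big)^{1/p}\le C\,p\,V\,\frac{\log\log n}{\log n}\,\big(1+o_{V,\mathcal{D},p}(1)\big),$$ where $o_{V,\mathcal{D},p}(1)$ denotes a quantity depending on $V$, $\|\mathcal{D}\|_{\psi_1}$ and $p$ (and $n$) that goes to $0$ as $n\to\infty$.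
   Context: Uncoupled isotonic regression model: $x_1<\dots<x_n$ are fixed deterministic distinct design points in $[0,1]$, and $y_i=f(x_i)+\xi_i$ for $1\le i\le n$, where $\xi_1,\dots,\xi_n$ are i.i.d. from $\mathcal{D}$. One observes only the unordered sets (multisets) $\{x_1,\dots,x_n\}$ and $\{y_1,\dots,y_n\}$, i.e. the pairing between the $x$'s and $y$'s is not observed. $V$ and $\mathcal{D}$ are known. $\mathcal{F}_V$ is the class of nondecreasing functions $f:[0,1]\to\mathbb{R}$ with $|f(x)|\le V$ for all $x\in[0,1]$. The norm is empirical: for $g:[0,1]\to\mathbb{R}$, $\|g\|_p^p:=\frac1n\sum_{i=1}^n|g(x_i)|^p$. Orlicz norm: for a random variable $X$, $\|X\|_{\psi_1}:=\inf\{t>0:\mathbb{E}[e^{|X|/t}-1]\le 1\}$; $\mathcal{D}$ is sub-exponential if $\|\mathcal{D}\|_{\psi_1}:=\|\xi\|_{\psi_1}<\infty$ for $\xi\sim\mathcal{D}$. "Universal constant" means independent of $n,V,\mathcal{D},p,f$ and the design points. $\log$ is the natural logarithm. *)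

theory Defs
  imports "HOL-Probability.Probability" "HOL-Library.Multiset"
begin

text \<open>Only the values on the unit interval are constrained: functions on it are represented by
  total functions that are never evaluated outside it.\<close>

definition mono_class :: "real \<Rightarrow> (real \<Rightarrow> real) set" where
  "mono_class V = {f. mono_on {0..1} f \<and> (\<forall>t\<in>{0..1}. \<bar>f t\<bar> \<le> V)}"

definition design :: "nat \<Rightarrow> (nat \<Rightarrow> real) \<Rightarrow> bool" where
  "design n x \<longleftrightarrow> (\<forall>i\<in>{1..n}. x i \<in> {0..1}) \<and> strict_mono_on {1..n} x"

text \<open>The \<open>p\<close>-th power of the empirical norm of \<open>g\<close>.\<close>

definition emp_norm_pow :: "nat \<Rightarrow> (nat \<Rightarrow> real) \<Rightarrow> real \<Rightarrow> (real \<Rightarrow> real) \<Rightarrow> real" where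
  "emp_norm_pow n x p g = (\<Sum>i=1..n. \<bar>g (x i)\<bar> powr p) / real n"

text \<open>The value is \<open>\<infinity>\<close> if no \<open>t\<close> is admissible. The integrand is nonnegative, and the
  nonnegative integral is \<open>\<infinity>\<close> when the exponential moment does not exist.\<close>

definition psi1_norm :: "'a measure \<Rightarrow> ('a \<Rightarrow> real) \<Rightarrow> ennreal" where
  "psi1_norm M X =
     (INF t \<in> {t. 0 < t \<and> (\<integral>\<^sup>+\<omega>. ennreal (exp (\<bar>X \<omega>\<bar> / t) - 1) \<partial>M) \<le> 1}. ennreal t)"

definition borel_law :: "real measure \<Rightarrow> bool" where
  "borel_law D \<longleftrightarrow> prob_space D \<and> sets D = sets borel"

definition centered :: "real measure \<Rightarrow> bool" where
  "centered D \<longleftrightarrow> integrable D (\<lambda>u. u) \<and> (\<integral>u. u \<partial>D) = 0"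

definition sub_exponential :: "real measure \<Rightarrow> bool" where
  "sub_exponential D \<longleftrightarrow> psi1_norm D (\<lambda>u. u) < \<infinity>"

text \<open>The values \<open>z 1, \<dots>, z n\<close> without their labels.\<close>

definition unlabelled :: "nat \<Rightarrow> (nat \<Rightarrow> real) \<Rightarrow> real multiset" where
  "unlabelled n z = image_mset z (mset_set {1..n})"

text \<open>An estimator only sees the two multisets of design points and of responses. Measurability is
  with respect to the sigma-algebra that multisets of size \<open>n\<close> inherit from \<open>n\<close>-dimensional space
  as a quotient, and to the sigma-algebra on functions generated by the evaluations.\<close>

type_synonym estimator = "real multiset \<Rightarrow> real multiset \<Rightarrow> real \<Rightarrow> real"

definition measurable_estimator :: "nat \<Rightarrow> estimator \<Rightarrow> bool" where
  "measurable_estimator n est \<longleftrightarrow>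
     (\<forall>t\<in>{0..1}. (\<lambda>(x, y). est (unlabelled n x) (unlabelled n y) t)
        \<in> borel_measurable ((\<Pi>\<^sub>M i\<in>{1..n}. borel) \<Otimes>\<^sub>M (\<Pi>\<^sub>M i\<in>{1..n}. borel)))"

text \<open>The expectation is over i.i.d. noise \<open>\<xi> 1, \<dots>, \<xi> n\<close>, i.e. over the product of \<open>n\<close> copies
  of \<open>D\<close>. As a nonnegative integral it is \<open>\<infinity>\<close> rather than \<open>0\<close> in the non-integrable case.\<close>

definition expected_loss ::
  "nat \<Rightarrow> (nat \<Rightarrow> real) \<Rightarrow> real measure \<Rightarrow> real \<Rightarrow> estimator \<Rightarrow> (real \<Rightarrow> real) \<Rightarrow> ennreal" where
  "expected_loss n x D p est f =
     (\<integral>\<^sup>+\<xi>. ennreal (emp_norm_pow n x p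
          (\<lambda>t. f t - est (unlabelled n x) (unlabelled n (\<lambda>i. f (x i) + \<xi> i)) t))
      \<partial>(\<Pi>\<^sub>M i\<in>{1..n}. D))"

definition ereal_root :: "real \<Rightarrow> ennreal \<Rightarrow> ereal" where
  "ereal_root p e = (if e = \<infinity> then \<infinity> else ereal (enn2real e powr (1 / p)))"

definition worst_case_risk ::
  "real \<Rightarrow> nat \<Rightarrow> (nat \<Rightarrow> real) \<Rightarrow> real measure \<Rightarrow> real \<Rightarrow> estimator \<Rightarrow> ereal" where
  "worst_case_risk V n x D p est =
     (SUP f \<in> mono_class V. ereal_root p (expected_loss n x D p est f))"

end

theory Submission
  imports Defs "HOL-Computational_Algebra.Polynomial" "HOL-Real_Asymp.Real_Asymp"
begin

text \<open>
  Only the two multisets are observed, so what can be estimated is the distribution of the values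
  \<open>f (x i)\<close>; by monotonicity their sorted sequence already determines \<open>f\<close> at the design points.
  The noise law being known, the power moments of that distribution have unbiased estimators:
  there are polynomials \<open>A\<close> of degree \<open>k\<close> with expectation \<open>A (v + \<xi>) = v^k\<close> (\<open>deconv_power\<close>,
  \<open>integral_deconv_power\<close>). Their variance is at most \<open>(k!)\<^sup>2\<close> times a factor exponential in \<open>k\<close>,
  so by Chebyshev's inequality the first \<open>K\<close> moments are known up to a negative power of \<open>n\<close> when
  \<open>K = c ln n / ln (ln n)\<close>, with a universal \<open>c\<close>. The estimator is a monotone sequence on a fine
  grid whose first \<open>K\<close> moments match these estimates.

  It remains to see that monotone sequences with values in \<open>[-1, 1]\<close> and almost equal first \<open>K\<close>
  moments are close: the mean of \<open>\<bar>f i - g i\<bar>^p\<close> is at most \<open>(C p / K)^p\<close> up to the amplified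
  moment error (\<open>sum_powr_diff_le_degree\<close>). In terms of optimal transport this bounds the \<open>p\<close>-th
  Wasserstein distance by matching moments. For a level \<open>z\<close> let \<open>S\<close> be a polynomial of degree at
  most \<open>K\<close> that approximates the indicator of \<open>t \<le> z\<close>, with values in \<open>[0, 1]\<close> and error
  \<open>(a / \<bar>t - z\<bar>)^q\<close>, where \<open>a\<close> is of order \<open>q / K\<close> (\<open>step_polynomial\<close>, obtained from powers of a
  Chebyshev kernel). The sums of \<open>S\<close> over the two sequences nearly agree, so few indices can have
  \<open>f i\<close> well below \<open>z\<close> and \<open>g i\<close> well above (\<open>card_crossings\<close>). Summing over the levels \<open>z\<close> in a
  grid of width \<open>d\<close> bounds the proportion of indices with \<open>\<bar>f i - g i\<bar> \<ge> 3 d\<close> by a multiple of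
  \<open>(a / d)^q\<close> (\<open>card_large_increments\<close>), and with \<open>q \<ge> p + 2\<close> the \<open>p\<close>-th powers can be summed over
  the sizes of the differences. Taking \<open>q\<close> proportional to \<open>p\<close> gives the factor \<open>p / K\<close>. The scale
  of the noise only affects lower order terms, and the order \<open>p\<close> only enters the analysis, not the
  estimator.
\<close>

section \<open>Polynomials with controlled coefficients\<close>

text \<open>The sum of the absolute values of the coefficients is the factor by which errors in the power
  moments are amplified when a polynomial is integrated. It is submultiplicative, and substituting
  a polynomial of norm at most one does not increase it; this is what keeps the test functions
  below under control without looking at their coefficients.\<close>

definition coeff_norm :: "real poly \<Rightarrow> real" where
  "coeff_norm P = (\<Sum>k\<le>degree P. \<bar>coeff P k\<bar>)"

lemma coeff_norm_eq_sum:
  assumes "degree P \<le> K"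
  shows "coeff_norm P = (\<Sum>k\<le>K. \<bar>coeff P k\<bar>)"
  unfolding coeff_norm_def
  by (rule sum.mono_neutral_left) (use assms in \<open>auto simp: coeff_eq_0\<close>)

lemma coeff_norm_nonneg: "0 \<le> coeff_norm P"
  by (simp add: coeff_norm_def sum_nonneg)

lemma coeff_norm_pCons: "coeff_norm (pCons a P) = \<bar>a\<bar> + coeff_norm P"
proof -
  have "coeff_norm (pCons a P) = (\<Sum>k\<le>Suc (degree P). \<bar>coeff (pCons a P) k\<bar>)"
    by (rule coeff_norm_eq_sum) (simp add: degree_pCons_le)
  also have "\<dots> = \<bar>a\<bar> + (\<Sum>k\<le>degree P. \<bar>coeff P k\<bar>)"
    by (subst sum.atMost_Suc_shift) simp
  finally show ?thesis by (simp add: coeff_norm_def)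
qed

lemma coeff_norm_0: "coeff_norm 0 = 0"
  by (simp add: coeff_norm_def)

lemma coeff_norm_1: "coeff_norm 1 = 1"
  by (simp add: coeff_norm_def)

lemma coeff_norm_add: "coeff_norm (P + Q) \<le> coeff_norm P + coeff_norm Q"
proof -
  define K where "K = max (degree P) (degree Q)"
  have "coeff_norm (P + Q) = (\<Sum>k\<le>K. \<bar>coeff (P + Q) k\<bar>)"
    by (rule coeff_norm_eq_sum) (simp add: K_def degree_add_le_max)
  also have "\<dots> \<le> (\<Sum>k\<le>K. \<bar>coeff P k\<bar> + \<bar>coeff Q k\<bar>)"
    by (intro sum_mono) simp
  also have "\<dots> = coeff_norm P + coeff_norm Q"
    by (simp add: sum.distrib coeff_norm_eq_sum[of P K] coeff_norm_eq_sum[of Q K] K_def)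
  finally show ?thesis .
qed

lemma coeff_norm_smult: "coeff_norm (smult c P) = \<bar>c\<bar> * coeff_norm P"
  by (simp add: coeff_norm_eq_sum[of "smult c P" "degree P"] coeff_norm_def degree_smult_le
      abs_mult sum_distrib_left)

lemma coeff_norm_diff: "coeff_norm (P - Q) \<le> coeff_norm P + coeff_norm Q"
  using coeff_norm_add[of P "smult (-1) Q"] unfolding coeff_norm_smult by simp

lemma coeff_norm_mult: "coeff_norm (P * Q) \<le> coeff_norm P * coeff_norm Q"
proof (induction P rule: pCons_induct)
  case 0
  show ?case by (simp add: coeff_norm_0)
next
  case (pCons a P)
  have "coeff_norm (pCons a P * Q) \<le> coeff_norm (smult a Q) + coeff_norm (pCons 0 (P * Q))"
    by (simp add: coeff_norm_add)
  also have "\<dots> \<le> \<bar>a\<bar> * coeff_norm Q + coeff_norm P * coeff_norm Q"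
    using pCons.IH by (simp add: coeff_norm_smult coeff_norm_pCons)
  finally show ?case by (simp add: coeff_norm_pCons algebra_simps)
qed

lemma coeff_norm_power: "coeff_norm (P ^ k) \<le> coeff_norm P ^ k"
proof (induction k)
  case 0
  show ?case by (simp add: coeff_norm_1)
next
  case (Suc k)
  have "coeff_norm (P ^ Suc k) \<le> coeff_norm P * coeff_norm (P ^ k)"
    by (simp add: coeff_norm_mult)
  also have "\<dots> \<le> coeff_norm P * coeff_norm P ^ k"
    by (intro mult_left_mono Suc.IH coeff_norm_nonneg)
  finally show ?case by simp
qed

lemma coeff_norm_pcompose:
  assumes "coeff_norm Q \<le> 1"
  shows "coeff_norm (pcompose P Q) \<le> coeff_norm P"
proof (induction P rule: pCons_induct)
  case 0
  show ?case by (simp add: coeff_norm_0)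
next
  case (pCons a P)
  have "coeff_norm (pcompose (pCons a P) Q) \<le> coeff_norm [:a:] + coeff_norm (Q * pcompose P Q)"
    by (simp add: pcompose_pCons coeff_norm_add)
  also have "coeff_norm (Q * pcompose P Q) \<le> coeff_norm Q * coeff_norm (pcompose P Q)"
    by (rule coeff_norm_mult)
  also have "\<dots> \<le> 1 * coeff_norm P"
    using pCons.IH assms by (intro mult_mono) (auto simp: coeff_norm_nonneg)
  finally show ?case by (simp add: coeff_norm_pCons coeff_norm_0)
qed

lemma coeff_norm_monom: "coeff_norm (monom c k) = \<bar>c\<bar>"
proof -
  have "coeff_norm (monom c k) = (\<Sum>j\<le>k. \<bar>coeff (monom c k) j\<bar>)"
    by (rule coeff_norm_eq_sum) (simp add: degree_monom_le)
  also have "\<dots> = (\<Sum>j\<in>{k}. \<bar>coeff (monom c k) j\<bar>)"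
    by (rule sum.mono_neutral_right) auto
  finally show ?thesis by simp
qed

lemma coeff_norm_sum: "finite A \<Longrightarrow> coeff_norm (\<Sum>k\<in>A. P k) \<le> (\<Sum>k\<in>A. coeff_norm (P k))"
proof (induction A rule: finite_induct)
  case empty
  show ?case by (simp add: coeff_norm_0)
next
  case (insert x A)
  then show ?case using coeff_norm_add[of "P x" "\<Sum>k\<in>A. P k"] by simp
qed

lemma antiderivative_with_small_coeffs:
  obtains P where "pderiv P = Q" "degree P \<le> Suc (degree Q)" "coeff_norm P \<le> coeff_norm Q"
proof
  define P where "P = (\<Sum>k\<le>degree Q. monom (coeff Q k / real (Suc k)) (Suc k))"
  show "pderiv P = Q"
    unfolding P_def higher_pderiv_sum[of 1, simplified]
    by (subst (2) poly_as_sum_of_monoms[of Q, symmetric]) (simp add: pderiv_monom)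
  show "degree P \<le> Suc (degree Q)"
    unfolding P_def
    by (intro degree_sum_le) (auto intro!: order.trans[OF degree_monom_le])
  have "coeff_norm P \<le> (\<Sum>k\<le>degree Q. \<bar>coeff Q k / real (Suc k)\<bar>)"
    unfolding P_def by (rule order.trans[OF coeff_norm_sum]) (simp_all add: coeff_norm_monom)
  also have "\<dots> \<le> (\<Sum>k\<le>degree Q. \<bar>coeff Q k\<bar>)"
    by (intro sum_mono) (simp add: abs_divide divide_le_eq mult_le_cancel_left1)
  finally show "coeff_norm P \<le> coeff_norm Q" by (simp add: coeff_norm_def)
qed

lemma poly_sum_diff_le_coeff_norm:
  fixes f g :: "nat \<Rightarrow> real"
  assumes "degree P \<le> K" "\<And>k. k \<le> K \<Longrightarrow> \<bar>(\<Sum>i\<in>I. f i ^ k) - (\<Sum>i\<in>I. g i ^ k)\<bar> \<le> \<delta>"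
  shows "\<bar>(\<Sum>i\<in>I. poly P (f i)) - (\<Sum>i\<in>I. poly P (g i))\<bar> \<le> coeff_norm P * \<delta>"
proof -
  have *: "(\<Sum>i\<in>I. poly P (h i)) = (\<Sum>k\<le>degree P. coeff P k * (\<Sum>i\<in>I. h i ^ k))"
    for h :: "nat \<Rightarrow> real"
    unfolding poly_altdef sum_distrib_left by (rule sum.swap)
  have "(\<Sum>i\<in>I. poly P (f i)) - (\<Sum>i\<in>I. poly P (g i))
      = (\<Sum>k\<le>degree P. coeff P k * ((\<Sum>i\<in>I. f i ^ k) - (\<Sum>i\<in>I. g i ^ k)))"
    by (simp add: * sum_subtractf right_diff_distrib)
  also have "\<bar>\<dots>\<bar> \<le> (\<Sum>k\<le>degree P. \<bar>coeff P k\<bar> * \<delta>)"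
    by (rule order.trans[OF sum_abs]) (use assms in \<open>auto intro!: sum_mono mult_left_mono simp: abs_mult\<close>)
  finally show ?thesis by (simp add: coeff_norm_def sum_distrib_right)
qed

section \<open>A polynomial kernel that is concentrated near zero\<close>

text \<open>This is \<open>sin ((2m+1)t) / sin t\<close> written as a polynomial in \<open>sin t\<close>, equivalently \<open>\<plusminus>T (u) / u\<close>
  for the Chebyshev polynomial \<open>T\<close> of degree \<open>2m+1\<close>. The recursion is the addition theorem with
  step \<open>2t\<close>, as \<open>2 cos (2t) = 2 - 4 sin\<^sup>2 t\<close>.\<close>

fun odd_kernel :: "nat \<Rightarrow> real poly" where
  "odd_kernel 0 = 1"
| "odd_kernel (Suc 0) = [:3, 0, -4:]"
| "odd_kernel (Suc (Suc m)) = [:2, 0, -4:] * odd_kernel (Suc m) - odd_kernel m"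

lemma sin_times_odd_kernel:
  "sin t * poly (odd_kernel m) (sin t) = sin (real (2 * m + 1) * t)"
proof (induction m rule: odd_kernel.induct)
  case 2
  have "sin (3 * t) = sin (2 * t + t)" by simp
  also have "\<dots> = 3 * sin t - 4 * sin t ^ 3"
  proof -
    have "cos t * cos t = 1 - sin t * sin t"
      using sin_cos_squared_add[of t] by (simp add: power2_eq_square)
    then show ?thesis
      unfolding sin_add sin_double cos_double_sin power2_eq_square power3_eq_cube by algebra
  qed
  finally show ?case by (simp add: algebra_simps power3_eq_cube)
next
  case (3 m)
  define w where "w = real (2 * m + 3) * t"
  have *: "real (2 * Suc (Suc m) + 1) * t = w + 2 * t" "real (2 * m + 1) * t = w - 2 * t"
    "real (2 * Suc m + 1) * t = w"
    by (auto simp: w_def algebra_simps)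
  have "sin (w + 2 * t) = 2 * cos (2 * t) * sin w - sin (w - 2 * t)"
    by (simp add: sin_add sin_diff)
  also have "2 * cos (2 * t) = 2 - 4 * (sin t)\<^sup>2"
    by (simp add: cos_double_sin)
  finally show ?case
    unfolding * odd_kernel.simps using 3 unfolding *
    by (simp only: poly_diff poly_mult) (simp, algebra)
qed simp

lemma poly_odd_kernel_0: "poly (odd_kernel m) 0 = real (2 * m + 1)"
  by (induction m rule: odd_kernel.induct) auto

lemma odd_kernel_minus: "poly (odd_kernel m) (- u) = poly (odd_kernel m) u"
  by (induction m rule: odd_kernel.induct) auto

lemma degree_odd_kernel: "degree (odd_kernel m) \<le> 2 * m"
proof (induction m rule: odd_kernel.induct)
  case (3 m)
  have "degree ([:2, 0, -4:] * odd_kernel (Suc m)) \<le> 2 + degree (odd_kernel (Suc m))"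
    by (rule order.trans[OF degree_mult_le]) simp
  then show ?case using 3 by (auto intro!: degree_diff_le)
qed auto

lemma coeff_norm_odd_kernel: "coeff_norm (odd_kernel m) \<le> 7 ^ m"
proof (induction m rule: odd_kernel.induct)
  case (3 m)
  have "coeff_norm ([:2, 0, -4:] * odd_kernel (Suc m)) \<le> 6 * coeff_norm (odd_kernel (Suc m))"
    using coeff_norm_mult[of "[:2, 0, -4:]" "odd_kernel (Suc m)"]
    by (simp add: coeff_norm_pCons coeff_norm_0)
  then have "coeff_norm (odd_kernel (Suc (Suc m))) \<le> 6 * 7 ^ Suc m + 7 ^ m"
    using 3 coeff_norm_diff[of "[:2, 0, -4:] * odd_kernel (Suc m)" "odd_kernel m"] by simp
  also have "\<dots> \<le> 7 ^ Suc (Suc m)" by simp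
  finally show ?case .
qed (auto simp: coeff_norm_1 coeff_norm_pCons coeff_norm_0)

text \<open>Together with the lower bound \<open>(2m+1)/2\<close> near zero proved below, the decay \<open>1/\<bar>u\<bar>\<close> makes high
  powers of the kernel concentrate at scale \<open>1/(2m+1)\<close>, although it is only a polynomial of degree
  \<open>2m\<close>.\<close>

lemma odd_kernel_decay:
  assumes "\<bar>u\<bar> \<le> 1"
  shows "\<bar>u * poly (odd_kernel m) u\<bar> \<le> 1"
  using sin_times_odd_kernel[of "arcsin u" m] assms by (simp add: sin_arcsin)

lemma sin_ge_half:
  assumes "0 \<le> x" "x \<le> (1::real)"
  shows "x / 2 \<le> sin x"
proof -
  have "sin 0 - 0 / 2 \<le> sin x - x / 2"
  proof (rule DERIV_nonneg_imp_nondecreasing[OF assms(1)])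
    fix y :: real assume y: "0 \<le> y" "y \<le> x"
    have "1 / 2 = cos (pi / 3)" by (simp add: cos_60)
    also have "\<dots> \<le> cos y"
      using y assms pi_gt3 by (subst cos_mono_le_eq) auto
    finally show "\<exists>D. ((\<lambda>x. sin x - x / 2) has_real_derivative D) (at y) \<and> 0 \<le> D"
      by (intro exI[of _ "cos y - 1/2"]) (auto intro!: derivative_eq_intros)
  qed
  then show ?thesis by simp
qed

lemma odd_kernel_large_near_0:
  assumes "0 \<le> u" "u \<le> 1 / (2 * real (2 * m + 1))"
  shows "real (2 * m + 1) / 2 \<le> poly (odd_kernel m) u"
proof (cases "u = 0")
  case True
  then show ?thesis using poly_odd_kernel_0[of m] by simp
next
  case False
  define M where "M = real (2 * m + 1)"
  have M: "1 \<le> M" by (simp add: M_def)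
  define t where "t = arcsin u"
  have M1: "0 \<le> 1 / M" "1 / M \<le> 1" "1 / (2 * M) \<le> 1" using M by (auto simp: divide_le_eq)
  have u1: "u \<le> 1" using assms(2) M1(3) unfolding M_def by linarith
  have st: "sin t = u" using assms u1 by (simp add: t_def)
  have u0: "0 < u" using False assms by simp
  have t0: "0 < t"
    using u0 u1 arcsin_less_mono[of 0 u] by (simp add: t_def)
  have "1 / (2 * M) \<le> sin (1 / M)"
    using sin_ge_half[of "1 / M"] M by simp
  moreover have "arcsin (sin (1 / M)) = 1 / M"
    by (rule arcsin_sin) (use M1 pi_gt3 in linarith)+
  ultimately have "t \<le> 1 / M"
    using arcsin_le_arcsin[of u "sin (1 / M)"] assms u0 by (simp add: t_def M_def)
  then have Mt: "M * t \<le> 1" using M by (simp add: field_simps)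
  have "M / 2 * u \<le> M / 2 * t"
    using M t0 sin_x_le_x[of t] st by (intro mult_left_mono) auto
  also have "\<dots> \<le> sin (M * t)"
    using sin_ge_half[of "M * t"] Mt M t0 by simp
  also have "\<dots> = u * poly (odd_kernel m) u"
    using sin_times_odd_kernel[of t m] by (simp add: st M_def)
  finally show ?thesis using u0 by (simp add: M_def mult.commute)
qed

section \<open>Polynomial approximation of a step\<close>

text \<open>Adding \<open>1 / (q u^q)\<close>, whose derivative is \<open>- 1 / u^(q+1)\<close>, to \<open>F\<close> gives a nonincreasing
  function. This replaces the integral of the kernel over its tail.\<close>

lemma antiderivative_tail:
  assumes P: "\<And>u. \<bar>u\<bar> \<le> 1 \<Longrightarrow> (F has_real_derivative F' u) (at u)"
    and F': "\<And>u. 0 < u \<Longrightarrow> u \<le> 1 \<Longrightarrow> F' u * u ^ Suc q \<le> 1" and q: "1 \<le> q"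
    and v: "0 < v" "v \<le> 1"
  shows "F 1 - F v \<le> 1 / v ^ q"
proof -
  define G where "G u = F u + (1 / real q) * inverse (u ^ q)" for u
  have "G 1 \<le> G v"
  proof (rule DERIV_nonpos_imp_nonincreasing[OF v(2)])
    fix u assume u: "v \<le> u" "u \<le> 1"
    then have u0: "0 < u" using v by simp
    obtain q' where q': "q = Suc q'" using q by (cases q) auto
    have "((\<lambda>u. inverse (u ^ q)) has_real_derivative - (real q * u ^ (q - 1)) / (u ^ q)\<^sup>2) (at u)"
      using u0 by (auto intro!: derivative_eq_intros simp: power2_eq_square field_simps)
    then have "(G has_real_derivative F' u + (1 / real q) * (- (real q * u ^ (q - 1)) / (u ^ q)\<^sup>2)) (at u)"
      unfolding G_def using u u0 by (intro DERIV_add P DERIV_cmult) auto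
    moreover have "(1 / real q) * (- (real q * u ^ (q - 1)) / (u ^ q)\<^sup>2) = - 1 / u ^ Suc q"
    proof -
      have "(1 / real q) * (- (real q * w) / (u * w)\<^sup>2) = - 1 / (u * (u * w))" if "w \<noteq> 0" for w
        using that u0 q by (simp add: power2_eq_square divide_simps)
      from this[of "u ^ q'"] show ?thesis using u0 by (simp add: q')
    qed
    moreover have "F' u \<le> 1 / u ^ Suc q"
      using F'[OF u0 u(2)] u0 by (simp add: field_simps)
    ultimately show "\<exists>y. (G has_real_derivative y) (at u) \<and> y \<le> 0"
      by (intro exI[of _ "F' u + (1 / real q) * (- (real q * u ^ (q - 1)) / (u ^ q)\<^sup>2)"]) auto
  qed
  then have "F 1 - F v \<le> (1 / real q) * (1 / v ^ q) - 1 / real q"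
    by (simp add: G_def divide_inverse)
  also have "\<dots> \<le> 1 * (1 / v ^ q)"
  proof -
    have "(1 / real q) * (1 / v ^ q) \<le> 1 * (1 / v ^ q)"
      using q v by (intro mult_right_mono) (auto simp: divide_simps)
    moreover have "0 \<le> 1 / real q" by simp
    ultimately show ?thesis by linarith
  qed
  finally show ?thesis by simp
qed

text \<open>The approximate step is the normalised antiderivative of the \<open>2r\<close>-th power of the kernel. The
  even power makes the kernel nonnegative, so the step is monotone with values in the unit
  interval, and its error at distance \<open>u\<close> from the jump is the tail mass of the kernel. The total
  mass is at least its mass on \<open>[0, 1/(2(2m+1))]\<close>, where \<open>odd_kernel m\<close> is at least half its
  maximum.

  The decay is polynomial of arbitrary order \<open>q = 2r - 1\<close>, at the price of a degree proportional
  to \<open>r\<close> for a fixed resolution. Since the \<open>p\<close>-th power of the loss needs about \<open>q = p + 2\<close>, this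
  trade-off is the source of the factor \<open>p\<close> in the rate.\<close>

lemma step_polynomial:
  assumes m: "1 \<le> m" and r: "1 \<le> r"
  obtains P :: "real poly" where
    "degree P \<le> 4 * r * m + 1" "coeff_norm P \<le> 8 * 7 ^ (2 * r * m)"
    "\<And>u. \<bar>u\<bar> \<le> 1 \<Longrightarrow> 0 \<le> poly P u \<and> poly P u \<le> 1"
    "\<And>u. 0 < u \<Longrightarrow> u \<le> 1 \<Longrightarrow> poly P u \<le> (8 / (real (2 * m + 1) * u)) ^ (2 * r - 1)"
    "\<And>u. 0 < u \<Longrightarrow> u \<le> 1 \<Longrightarrow> 1 - poly P (- u) \<le> (8 / (real (2 * m + 1) * u)) ^ (2 * r - 1)"
proof -
  define M where "M = real (2 * m + 1)"
  have M: "3 \<le> M" using m by (simp add: M_def)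
  define q where "q = 2 * r - 1"
  have q: "1 \<le> q" "2 * r = Suc q" using r by (auto simp: q_def)
  define k where "k = odd_kernel m ^ (2 * r)"
  obtain F where F: "pderiv F = k" "degree F \<le> Suc (degree k)" "coeff_norm F \<le> coeff_norm k"
    by (rule antiderivative_with_small_coeffs)
  have dF: "(poly F has_real_derivative poly k u) (at u)" for u
    using poly_DERIV[of F u] F by simp
  have k0: "0 \<le> poly k u" for u by (simp add: k_def power_mult)
  have keven: "poly k (- u) = poly k u" for u by (simp add: k_def odd_kernel_minus)
  have mono: "poly F u \<le> poly F v" if "u \<le> v" for u v
    by (rule DERIV_nonneg_imp_nondecreasing[OF that]) (use dF k0 in blast)
  have ktail: "poly k u * u ^ Suc q \<le> 1" if "\<bar>u\<bar> \<le> 1" for u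
  proof -
    have "poly k u * u ^ Suc q = (u * poly (odd_kernel m) u) ^ Suc q"
      by (simp add: k_def q power_mult_distrib)
    also have "\<dots> \<le> \<bar>u * poly (odd_kernel m) u\<bar> ^ Suc q"
      by (metis abs_ge_self power_abs)
    also have "\<dots> \<le> 1"
      using odd_kernel_decay[OF that, of m] by (intro power_le_one) auto
    finally show ?thesis .
  qed
  define D where "D = poly F 1 - poly F (-1)"
  have D: "(M / 2) ^ q / 4 \<le> D"
  proof -
    define G where "G a = poly F a - (M / 2) ^ Suc q * a" for a
    have "G 0 \<le> G (1 / (2 * M))"
    proof (rule DERIV_nonneg_imp_nondecreasing[of 0 "1 / (2 * M)" G])
      fix u assume u: "0 \<le> u" "u \<le> 1 / (2 * M)"
      have "(M / 2) ^ Suc q \<le> poly (odd_kernel m) u ^ Suc q"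
        using odd_kernel_large_near_0[of u m] u M by (intro power_mono) (auto simp: M_def)
      then have "0 \<le> poly k u - (M / 2) ^ Suc q" by (simp add: k_def q)
      then show "\<exists>y. (G has_real_derivative y) (at u) \<and> 0 \<le> y"
        unfolding G_def by (intro exI[of _ "poly k u - (M / 2) ^ Suc q"])
           (auto intro!: derivative_eq_intros dF simp: F)
    qed (use M in auto)
    moreover have "(M / 2) ^ Suc q * (1 / (2 * M)) = (M / 2) ^ q / 4"
      using M by simp
    moreover have "poly F (1 / (2 * M)) \<le> poly F 1" "poly F (-1) \<le> poly F 0"
      using M by (auto intro!: mono simp: field_simps)
    ultimately show ?thesis by (simp add: D_def G_def)
  qed
  have "1 \<le> (M / 2) ^ q" using M by (intro one_le_power) auto
  then have D4: "1 / 4 \<le> D" using D by simp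
  have tail: "x / D \<le> (8 / (M * u)) ^ q" if x: "x \<le> 1 / u ^ q" and u: "0 < u" for x u
  proof -
    have "x / D \<le> (1 / u ^ q) / D" using x D4 by (intro divide_right_mono) auto
    also have "\<dots> \<le> (1 / u ^ q) / ((M / 2) ^ q / 4)"
      using D u M D4 by (intro divide_left_mono) auto
    also have "\<dots> = 4 * (2 / (M * u)) ^ q"
      using M u by (simp add: power_divide power_mult_distrib field_simps)
    also have "\<dots> \<le> 4 ^ q * (2 / (M * u)) ^ q"
      using q M u by (intro mult_right_mono) (auto intro: self_le_power)
    also have "\<dots> = (8 / (M * u)) ^ q" by (simp flip: power_mult_distrib)
    finally show ?thesis .
  qed
  define P where "P = smult (1 / D) ([:poly F 1:] - F)"
  have P: "poly P u = (poly F 1 - poly F u) / D" for u by (simp add: P_def)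
  show ?thesis
  proof
    have "degree k \<le> 2 * m * (2 * r)"
      unfolding k_def using order.trans[OF degree_power_le[of "odd_kernel m" "2 * r"]
        mult_right_mono[OF degree_odd_kernel[of m]]] by simp
    then have "degree F \<le> 4 * r * m + 1" using F by (simp add: algebra_simps)
    then show "degree P \<le> 4 * r * m + 1"
      unfolding P_def using degree_diff_le[of "[:poly F 1:]" "4 * r * m + 1" F]
      by (intro order.trans[OF degree_smult_le]) simp
    have kn: "coeff_norm k \<le> 7 ^ (2 * r * m)"
    proof -
      have "coeff_norm k \<le> coeff_norm (odd_kernel m) ^ (2 * r)"
        by (simp add: k_def coeff_norm_power)
      also have "\<dots> \<le> (7 ^ m) ^ (2 * r)"
        by (intro power_mono coeff_norm_odd_kernel coeff_norm_nonneg)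
      finally show ?thesis by (simp add: power_mult[symmetric] mult.commute)
    qed
    have "\<bar>poly F 1\<bar> \<le> coeff_norm F"
      unfolding poly_altdef coeff_norm_def by (simp add: sum_abs)
    then have "coeff_norm ([:poly F 1:] - F) \<le> 2 * 7 ^ (2 * r * m)"
      using coeff_norm_diff[of "[:poly F 1:]" F] F kn by (simp add: coeff_norm_pCons coeff_norm_0)
    then have "1 / D * coeff_norm ([:poly F 1:] - F) \<le> 4 * (2 * 7 ^ (2 * r * m))"
      using D4 by (intro mult_mono) (auto simp: field_simps coeff_norm_nonneg)
    then show "coeff_norm P \<le> 8 * 7 ^ (2 * r * m)"
      using D4 by (simp add: P_def coeff_norm_smult)
    show "0 \<le> poly P u \<and> poly P u \<le> 1" if "\<bar>u\<bar> \<le> 1" for u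
      using mono[of u 1] mono[of "-1" u] that D4 by (auto simp: P D_def divide_simps)
    show "poly P u \<le> (8 / (real (2 * m + 1) * u)) ^ (2 * r - 1)" if u: "0 < u" "u \<le> 1" for u
      unfolding P M_def[symmetric] q_def[symmetric]
      by (intro tail antiderivative_tail[of "poly F" "poly k"] dF ktail u q) (use u in auto)
    show "1 - poly P (- u) \<le> (8 / (real (2 * m + 1) * u)) ^ (2 * r - 1)"
      if u: "0 < u" "u \<le> 1" for u
    proof -
      have "- poly F (- 1) - (- poly F (- u)) \<le> 1 / u ^ q"
      proof (rule antiderivative_tail[of "\<lambda>u. - poly F (- u)" "poly k"])
        show "((\<lambda>u. - poly F (- u)) has_real_derivative poly k u) (at u)" for u
        proof -
          have "((\<lambda>u. - poly F (- u)) has_real_derivative poly k (- u)) (at u)"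
            using DERIV_minus[OF DERIV_chain2[OF dF DERIV_minus[OF DERIV_ident]]] by simp
          then show ?thesis by (simp only: keven)
        qed
      qed (use u q ktail in auto)
      then have "(poly F (- u) - poly F (- 1)) / D \<le> (8 / (M * u)) ^ q"
        by (intro tail u) simp
      moreover have "1 - poly P (- u) = (poly F (- u) - poly F (- 1)) / D"
        using D4 by (simp add: P D_def field_simps)
      ultimately show ?thesis by (simp add: M_def q_def)
    qed
  qed
qed

section \<open>Monotone sequences with almost equal moments are close\<close>

text \<open>Telescoping, from \<open>1/z\<^sup>2 \<le> 2/(z(z+1)) = 2/z - 2/(z+1)\<close> for \<open>z \<ge> 1\<close>.\<close>

lemma sum_inverse_squares_nat:
  assumes "1 \<le> (y::real)"
  shows "(\<Sum>k<N. 1 / (y + real k)\<^sup>2) \<le> 2 / y"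
proof -
  have "(\<Sum>k<N. 1 / (y + real k)\<^sup>2) \<le> 2 / y - 2 / (y + real N)"
  proof (induction N)
    case (Suc N)
    define z where "z = y + real N"
    have z: "1 \<le> z" using assms by (simp add: z_def)
    have "1 / z\<^sup>2 \<le> 2 / (z * (z + 1))"
    proof -
      have "z * (z + 1) \<le> z\<^sup>2 * 2" using z by (simp add: power2_eq_square algebra_simps mult_le_cancel_left1)
      then have "2 / (z\<^sup>2 * 2) \<le> 2 / (z * (z + 1))" using z by (intro divide_left_mono) auto
      then show ?thesis by simp
    qed
    also have "\<dots> = 2 / z - 2 / (z + 1)"
      using z by (simp add: field_simps)
    finally show ?case using Suc by (simp add: z_def add.commute add.left_commute)
  qed simp
  moreover have "0 \<le> 2 / (y + real N)" using assms by simp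
  ultimately show ?thesis by linarith
qed

lemma sum_inverse_squares_right:
  assumes "finite (J :: int set)"
  shows "(\<Sum>j\<in>{j\<in>J. x + 1 \<le> real_of_int j}. 1 / (x - real_of_int j)\<^sup>2) \<le> 2"
proof -
  define c where "c = \<lceil>x\<rceil> + 1"
  define A where "A = {j\<in>J. x + 1 \<le> real_of_int j}"
  define y where "y = real_of_int c - x"
  have y: "1 \<le> y" by (simp add: y_def c_def)
  define N where "N = Suc (nat (Max (insert 0 ((\<lambda>j. j - c) ` A))))"
  have fA: "finite A" using assms by (simp add: A_def)
  have sub: "A \<subseteq> (\<lambda>k. c + int k) ` {..<N}"
  proof
    fix j assume j: "j \<in> A"
    then have "c \<le> j" by (auto simp: A_def c_def) linarith
    moreover have "j - c \<le> Max (insert 0 ((\<lambda>j. j - c) ` A))"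
      using fA j by (intro Max_ge) auto
    ultimately have "j = c + int (nat (j - c))" "nat (j - c) < N" by (auto simp: N_def)
    then show "j \<in> (\<lambda>k. c + int k) ` {..<N}" by blast
  qed
  have "(\<Sum>j\<in>A. 1 / (x - real_of_int j)\<^sup>2)
      \<le> (\<Sum>j\<in>(\<lambda>k. c + int k) ` {..<N}. 1 / (x - real_of_int j)\<^sup>2)"
    by (rule sum_mono2) (use sub in auto)
  also have "\<dots> = (\<Sum>k<N. 1 / (x - real_of_int (c + int k))\<^sup>2)"
    by (subst sum.reindex) (auto simp: inj_on_def)
  also have "\<dots> = (\<Sum>k<N. 1 / (y + real k)\<^sup>2)"
    by (rule sum.cong) (auto simp: y_def power2_commute[of x] algebra_simps)
  also have "\<dots> \<le> 2 / y" by (rule sum_inverse_squares_nat[OF y])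
  also have "\<dots> \<le> 2" using y by (simp add: divide_le_eq)
  finally show ?thesis by (simp add: A_def)
qed

lemma sum_inverse_squares_int:
  assumes "finite (J :: int set)"
  shows "(\<Sum>j\<in>{j\<in>J. 1 \<le> \<bar>x - real_of_int j\<bar>}. 1 / (x - real_of_int j)\<^sup>2) \<le> 4"
proof -
  let ?h = "\<lambda>x j. 1 / (x - real_of_int j)\<^sup>2"
  let ?L = "{j\<in>J. real_of_int j \<le> x - 1}"
  have "(\<Sum>j\<in>{j\<in>J. 1 \<le> \<bar>x - real_of_int j\<bar>}. ?h x j)
      \<le> (\<Sum>j\<in>{j\<in>J. x + 1 \<le> real_of_int j} \<union> ?L. ?h x j)"
    by (rule sum_mono2) (use assms in auto)
  also have "\<dots> = (\<Sum>j\<in>{j\<in>J. x + 1 \<le> real_of_int j}. ?h x j) + (\<Sum>j\<in>?L. ?h x j)"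
    by (rule sum.union_disjoint) (use assms in auto)
  also have "(\<Sum>j\<in>?L. ?h x j) = (\<Sum>j\<in>{j\<in>uminus ` J. - x + 1 \<le> real_of_int j}. ?h (- x) j)"
    by (rule sum.reindex_bij_witness[of _ uminus uminus]) (auto simp: power2_commute)
  also have "\<dots> \<le> 2"
    by (rule sum_inverse_squares_right) (use assms in simp)
  also have "(\<Sum>j\<in>{j\<in>J. x + 1 \<le> real_of_int j}. ?h x j) \<le> 2"
    by (rule sum_inverse_squares_right[OF assms])
  finally show ?thesis by simp
qed

text \<open>The indices where \<open>f\<close> is low form an initial segment, and so do those where \<open>g\<close> is low. Two
  initial segments are nested, so the number of indices in one but not in the other is the
  difference of two cardinalities or zero. Hence the number of pairs that jump over a level is
  controlled by the two sequences separately, that is by their empirical distributions; this is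
  where monotonicity replaces the missing pairing.\<close>

lemma card_crossings:
  fixes f g :: "nat \<Rightarrow> real"
  assumes mono: "mono_on {1..n} f" "mono_on {1..n} g"
    and up: "\<And>i. i \<in> {1..n} \<Longrightarrow> (if f i \<le> s then 1 else 0) \<le> \<phi> i"
    and lo: "\<And>i. i \<in> {1..n} \<Longrightarrow> \<psi> i \<le> (if g i < s' then 1 else 0)"
    and nonneg: "0 \<le> B" and B: "(\<Sum>i=1..n. \<phi> i) - (\<Sum>i=1..n. \<psi> i) \<le> B"
  shows "real (card {i\<in>{1..n}. f i \<le> s \<and> s' \<le> g i}) \<le> B"
proof -
  define A where "A = {i\<in>{1..n}. f i \<le> s}"
  define A' where "A' = {i\<in>{1..n}. g i < s'}"
  have eq: "{i\<in>{1..n}. f i \<le> s \<and> s' \<le> g i} = A - A'" by (auto simp: A_def A'_def)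
  have dA: "i \<in> A" if "j \<in> A" "i \<le> j" "1 \<le> i" for i j
    using that monotone_onD[OF mono(1), of i j] by (auto simp: A_def)
  have dA': "i \<in> A'" if "j \<in> A'" "i \<le> j" "1 \<le> i" for i j
    using that monotone_onD[OF mono(2), of i j] by (auto simp: A'_def)
  have "A \<subseteq> A' \<or> A' \<subseteq> A"
  proof (rule ccontr)
    assume "\<not> (A \<subseteq> A' \<or> A' \<subseteq> A)"
    then obtain i j where ij: "i \<in> A" "i \<notin> A'" "j \<in> A'" "j \<notin> A" by blast
    then show False
      using dA[of i j] dA'[of j i] by (cases "i \<le> j") (auto simp: A_def A'_def)
  qed
  then show ?thesis
  proof
    assume "A \<subseteq> A'"
    then show ?thesis unfolding eq using nonneg by (simp add: Diff_eq_empty_iff[THEN iffD2])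
  next
    assume sub: "A' \<subseteq> A"
    have fin: "finite A" "finite A'" by (auto simp: A_def A'_def)
    have "real (card (A - A')) = real (card A) - real (card A')"
      using sub fin card_mono[OF fin(1) sub] by (simp add: card_Diff_subset of_nat_diff)
    also have "real (card A) = (\<Sum>i=1..n. if f i \<le> s then 1 else 0)"
      by (simp add: A_def sum.If_cases Int_def)
    also have "\<dots> \<le> (\<Sum>i=1..n. \<phi> i)" by (rule sum_mono) (rule up)
    also have "real (card A') = (\<Sum>i=1..n. if g i < s' then 1 else 0)"
      by (simp add: A'_def sum.If_cases Int_def)
    also have "(\<Sum>i=1..n. \<phi> i) - \<dots> \<le> (\<Sum>i=1..n. \<phi> i) - (\<Sum>i=1..n. \<psi> i)"
      by (intro diff_left_mono sum_mono) (rule lo)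
    finally show ?thesis unfolding eq using B by linarith
  qed
qed

text \<open>If \<open>f i + 3d \<le> g i\<close>, some multiple \<open>z\<close> of \<open>d\<close> satisfies \<open>f i + d \<le> z \<le> g i - d\<close>. For fixed \<open>z\<close>
  such indices are counted with the polynomial step at \<open>z\<close>, which cannot tell \<open>f\<close> from \<open>g\<close> except
  through the moment error \<open>\<delta>\<close>. What remains is the approximation error \<open>(a/\<bar>t-z\<bar>)^q\<close> of the step
  at the points \<open>t\<close> of the two sequences. It is summed over \<open>z\<close> for each fixed \<open>t\<close>: because it
  decays at least quadratically, the sum is of the order of its largest term, so that the number
  \<open>2/d\<close> of levels multiplies \<open>\<delta>\<close> only. A factor \<open>2/d\<close> in front of \<open>(a/d)^q\<close> would spoil the rate.\<close>

lemma card_large_increments: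
  fixes f g :: "nat \<Rightarrow> real" and m r K n :: nat
  defines "a \<equiv> 16 / real (2 * m + 1)" and "q \<equiv> 2 * r - 1"
  assumes mono: "mono_on {1..n} f" "mono_on {1..n} g"
    and range: "\<And>i. i \<in> {1..n} \<Longrightarrow> \<bar>f i\<bar> \<le> 1" "\<And>i. i \<in> {1..n} \<Longrightarrow> \<bar>g i\<bar> \<le> 1"
    and m: "1 \<le> m" and r: "2 \<le> r" and K: "4 * r * m + 1 \<le> K"
    and mom: "\<And>k. k \<le> K \<Longrightarrow> \<bar>(\<Sum>i=1..n. f i ^ k) - (\<Sum>i=1..n. g i ^ k)\<bar> \<le> real n * \<delta>"
    and d: "0 < d"
  shows "real (card {i\<in>{1..n}. f i + 3 * d \<le> g i})
    \<le> real n * (8 * (a / d) ^ q + (2 / d + 1) * (8 * 7 ^ K) * \<delta>)"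
proof -
  have a: "0 < a" by (simp add: a_def)
  have r1: "1 \<le> r" using r by simp
  have q: "2 \<le> q" using r by (simp add: q_def)
  obtain P where P: "degree P \<le> 4 * r * m + 1" "coeff_norm P \<le> 8 * 7 ^ (2 * r * m)"
    "\<And>u. \<bar>u\<bar> \<le> 1 \<Longrightarrow> 0 \<le> poly P u \<and> poly P u \<le> 1"
    "\<And>u. 0 < u \<Longrightarrow> u \<le> 1 \<Longrightarrow> poly P u \<le> (8 / (real (2 * m + 1) * u)) ^ (2 * r - 1)"
    "\<And>u. 0 < u \<Longrightarrow> u \<le> 1 \<Longrightarrow> 1 - poly P (- u) \<le> (8 / (real (2 * m + 1) * u)) ^ (2 * r - 1)"
    by (rule step_polynomial[OF m r1]) blast
  have \<delta>: "0 \<le> real n * \<delta>" using mom[of 0] by simp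
  \<comment> \<open>The step is shifted to \<open>z\<close> and scaled by two, since \<open>t - z\<close> ranges over \<open>[-2, 2]\<close>.\<close>
  define S where "S z = pcompose P [:- z / 2, 1 / 2:]" for z :: real
  have S: "poly (S z) t = poly P ((t - z) / 2)" for z t
    by (simp add: S_def poly_pcompose field_simps)
  define e where "e z t = (if d \<le> \<bar>t - z\<bar> then (a / \<bar>t - z\<bar>) ^ q else 0)" for z t :: real
  have e0: "0 \<le> e z t" for z t using a by (simp add: e_def)
  have tail: "8 / (real (2 * m + 1) * (x / 2)) = a / x" for x
    by (simp add: a_def)
  have S01: "0 \<le> poly (S z) t \<and> poly (S z) t \<le> 1" if "\<bar>z\<bar> \<le> 1" "\<bar>t\<bar> \<le> 1" for z t
    unfolding S by (rule P(3)) (use that in \<open>auto simp: abs_le_iff\<close>)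
  \<comment> \<open>One-sided comparisons with the indicator of a half-line, shifted by \<open>d\<close> on either side: within
    distance \<open>d\<close> of the jump, only \<open>0 \<le> S \<le> 1\<close> is needed, so the error \<open>e\<close> may vanish there.\<close>
  have lower: "(if t \<le> z - d then 1 else 0) \<le> poly (S z) t + e z t" if "\<bar>z\<bar> \<le> 1" "\<bar>t\<bar> \<le> 1" for z t
  proof (cases "t \<le> z - d")
    case True
    have "1 - poly P (- ((z - t) / 2)) \<le> (8 / (real (2 * m + 1) * ((z - t) / 2))) ^ (2 * r - 1)"
      by (rule P(5)) (use True that d in \<open>auto simp: abs_le_iff\<close>)
    moreover have "- ((z - t) / 2) = (t - z) / 2" by (simp add: field_simps)
    ultimately show ?thesis
      using True d by (simp only: tail) (simp add: S e_def q_def)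
  next
    case False
    then show ?thesis using S01[OF that] e0[of z t] by simp
  qed
  have upper: "poly (S z) t - e z t \<le> (if t < z + d then 1 else 0)" if "\<bar>z\<bar> \<le> 1" "\<bar>t\<bar> \<le> 1" for z t
  proof (cases "t < z + d")
    case True
    then show ?thesis using S01[OF that] e0[of z t] by simp
  next
    case False
    have "poly P ((t - z) / 2) \<le> (8 / (real (2 * m + 1) * ((t - z) / 2))) ^ (2 * r - 1)"
      by (rule P(4)) (use False that d in \<open>auto simp: abs_le_iff\<close>)
    then show ?thesis using False d by (simp only: tail) (simp add: S e_def q_def)
  qed
  have coeffs: "\<bar>(\<Sum>i=1..n. poly (S z) (f i)) - (\<Sum>i=1..n. poly (S z) (g i))\<bar> \<le> (8 * 7 ^ K) * (real n * \<delta>)"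
    if "\<bar>z\<bar> \<le> 1" for z
  proof -
    have "degree (S z) \<le> K"
      unfolding S_def using P(1) K by (simp add: degree_pcompose)
    then have "\<bar>(\<Sum>i=1..n. poly (S z) (f i)) - (\<Sum>i=1..n. poly (S z) (g i))\<bar>
        \<le> coeff_norm (S z) * (real n * \<delta>)"
      by (rule poly_sum_diff_le_coeff_norm) (rule mom)
    also have "coeff_norm (S z) \<le> coeff_norm P"
      unfolding S_def using that by (intro coeff_norm_pcompose) (simp add: coeff_norm_pCons coeff_norm_0)
    also have "\<dots> \<le> 8 * 7 ^ K"
    proof (rule order.trans[OF P(2)])
      have "2 * r * m \<le> K" using K by linarith
      then show "8 * 7 ^ (2 * r * m) \<le> (8 * 7 ^ K :: real)" by (simp add: power_increasing)
    qed
    finally show ?thesis using \<delta> by (simp add: mult_right_mono)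
  qed
  \<comment> \<open>The multiples of \<open>d\<close> in \<open>[-1, 1]\<close>.\<close>
  define J where "J = {- \<lfloor>1 / d\<rfloor>..\<lfloor>1 / d\<rfloor>}"
  define z where "z j = real_of_int j * d" for j
  have z1: "\<bar>z j\<bar> \<le> 1" if "j \<in> J" for j
  proof -
    have "\<bar>j\<bar> \<le> \<lfloor>1 / d\<rfloor>" using that by (auto simp: J_def)
    then have "\<bar>real_of_int j\<bar> \<le> 1 / d" by (simp add: le_floor_iff)
    then show ?thesis using d by (simp add: z_def abs_mult field_simps)
  qed
  define X where "X j = {i\<in>{1..n}. f i \<le> z j - d \<and> z j + d \<le> g i}" for j
  have X: "real (card (X j)) \<le> (8 * 7 ^ K) * (real n * \<delta>) + (\<Sum>i=1..n. e (z j) (f i) + e (z j) (g i))"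
    (is "_ \<le> ?B") if j: "j \<in> J" for j
    unfolding X_def
  proof (rule card_crossings[OF mono])
    show "(if f i \<le> z j - d then 1 else 0) \<le> poly (S (z j)) (f i) + e (z j) (f i)"
      if "i \<in> {1..n}" for i
      by (rule lower[OF z1[OF j] range(1)[OF that]])
    show "poly (S (z j)) (g i) - e (z j) (g i) \<le> (if g i < z j + d then 1 else 0)"
      if "i \<in> {1..n}" for i
      by (rule upper[OF z1[OF j] range(2)[OF that]])
    show "0 \<le> ?B"
      using mult_nonneg_nonneg[OF _ \<delta>, of "8 * 7 ^ K"]
      by (intro add_nonneg_nonneg sum_nonneg) (auto simp: e0)
    show "(\<Sum>i=1..n. poly (S (z j)) (f i) + e (z j) (f i))
        - (\<Sum>i=1..n. poly (S (z j)) (g i) - e (z j) (g i)) \<le> ?B"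
      using coeffs[OF z1[OF j]] by (simp add: sum.distrib sum_subtractf)
  qed
  have finJ: "finite J" by (simp add: J_def)
  have sum_e: "(\<Sum>j\<in>J. e (z j) t) \<le> 4 * (a / d) ^ q" for t
  proof -
    let ?J = "{j\<in>J. 1 \<le> \<bar>t / d - real_of_int j\<bar>}"
    have scale: "\<bar>t - z j\<bar> = d * \<bar>t / d - real_of_int j\<bar>" for j
    proof -
      have "t - z j = d * (t / d - real_of_int j)" using d by (simp add: z_def field_simps)
      then show ?thesis using d by (simp add: abs_mult)
    qed
    have "(\<Sum>j\<in>J. e (z j) t) = (\<Sum>j\<in>?J. e (z j) t)"
      by (rule sum.mono_neutral_right) (use finJ d in \<open>auto simp: e_def scale\<close>)
    also have "\<dots> \<le> (\<Sum>j\<in>?J. (a / d) ^ q * (1 / (t / d - real_of_int j)\<^sup>2))"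
    proof (rule sum_mono)
      fix j assume j: "j \<in> ?J"
      define w where "w = \<bar>t / d - real_of_int j\<bar>"
      have w: "1 \<le> w" using j by (simp add: w_def)
      have "e (z j) t \<le> (a / (d * w)) ^ q" using a d w by (simp add: e_def scale w_def)
      also have "\<dots> = (a / d) ^ q * (1 / w ^ q)" by (simp add: power_divide power_mult_distrib)
      also have "\<dots> \<le> (a / d) ^ q * (1 / w\<^sup>2)"
        using w q a d by (intro mult_left_mono divide_left_mono power_increasing) auto
      finally show "e (z j) t \<le> (a / d) ^ q * (1 / (t / d - real_of_int j)\<^sup>2)" by (simp add: w_def)
    qed
    also have "\<dots> \<le> (a / d) ^ q * 4"
      unfolding sum_distrib_left[symmetric]
      using sum_inverse_squares_int[OF finJ, of "t / d"] a d by (intro mult_left_mono) auto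
    finally show ?thesis by simp
  qed
  have "{i\<in>{1..n}. f i + 3 * d \<le> g i} \<subseteq> (\<Union>j\<in>J. X j)"
  proof
    fix i assume i: "i \<in> {i\<in>{1..n}. f i + 3 * d \<le> g i}"
    define j where "j = \<lceil>(f i + d) / d\<rceil>"
    have "(f i + d) / d \<le> real_of_int j" "real_of_int j < (f i + d) / d + 1"
      unfolding j_def by linarith+
    then have zj: "f i + d \<le> z j" "z j < f i + 2 * d"
      using d by (auto simp: z_def field_simps)
    then have "\<bar>z j\<bar> \<le> 1" using range[of i] i d by auto
    then have "\<bar>real_of_int j\<bar> \<le> 1 / d" using d by (simp add: z_def abs_mult field_simps)
    then have "\<bar>j\<bar> \<le> \<lfloor>1 / d\<rfloor>" by (simp add: le_floor_iff)
    then have "j \<in> J" by (auto simp: J_def)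
    moreover have "i \<in> X j" using zj i d by (auto simp: X_def)
    ultimately show "i \<in> (\<Union>j\<in>J. X j)" by blast
  qed
  then have "card {i\<in>{1..n}. f i + 3 * d \<le> g i} \<le> card (\<Union>j\<in>J. X j)"
    by (intro card_mono) (auto simp: finJ X_def)
  also have "\<dots> \<le> (\<Sum>j\<in>J. card (X j))" by (rule card_UN_le[OF finJ])
  finally have "real (card {i\<in>{1..n}. f i + 3 * d \<le> g i}) \<le> (\<Sum>j\<in>J. real (card (X j)))"
    by (metis of_nat_le_iff of_nat_sum)
  also have "\<dots> \<le> (\<Sum>j\<in>J. (8 * 7 ^ K) * (real n * \<delta>) + (\<Sum>i=1..n. e (z j) (f i) + e (z j) (g i)))"
    by (intro sum_mono X)
  also have "\<dots> = real (card J) * ((8 * 7 ^ K) * (real n * \<delta>))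
      + ((\<Sum>i=1..n. \<Sum>j\<in>J. e (z j) (f i)) + (\<Sum>i=1..n. \<Sum>j\<in>J. e (z j) (g i)))"
    by (simp only: sum.distrib sum.swap[of _ _ J] sum_constant)
  also have "\<dots> \<le> (2 / d + 1) * ((8 * 7 ^ K) * (real n * \<delta>))
      + ((\<Sum>i=1..n. 4 * (a / d) ^ q) + (\<Sum>i=1..n. 4 * (a / d) ^ q))"
  proof (intro add_mono mult_right_mono sum_mono sum_e)
    have "0 \<le> \<lfloor>1 / d\<rfloor>" using d by simp
    then have "real (card J) = 2 * real_of_int \<lfloor>1 / d\<rfloor> + 1" by (simp add: J_def)
    moreover have "real_of_int \<lfloor>1 / d\<rfloor> \<le> 1 / d" by (rule of_int_floor_le)
    moreover have "2 / d = 2 * (1 / d)" by simp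
    ultimately show "real (card J) \<le> 2 / d + 1" by linarith
  qed (use \<delta> in auto)
  finally show ?thesis by (simp add: algebra_simps)
qed

text \<open>The differences are grouped by \<open>l = \<lfloor>\<bar>f i - g i\<bar> / (3a)\<rfloor>\<close>. At most about \<open>16 l^(-p-2) n\<close> of them
  belong to a level \<open>l \<ge> 1\<close>, and each contributes at most \<open>(6 a l)^p\<close>, so the levels sum like
  \<open>1/l\<^sup>2\<close>.\<close>

lemma sum_powr_diff_le:
  fixes f g :: "nat \<Rightarrow> real" and m r K n :: nat
  defines "a \<equiv> 16 / real (2 * m + 1)"
  assumes mono: "mono_on {1..n} f" "mono_on {1..n} g"
    and range: "\<And>i. i \<in> {1..n} \<Longrightarrow> \<bar>f i\<bar> \<le> 1" "\<And>i. i \<in> {1..n} \<Longrightarrow> \<bar>g i\<bar> \<le> 1"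
    and m: "1 \<le> m" and r: "2 \<le> r" and K: "4 * r * m + 1 \<le> K"
    and mom: "\<And>k. k \<le> K \<Longrightarrow> \<bar>(\<Sum>i=1..n. f i ^ k) - (\<Sum>i=1..n. g i ^ k)\<bar> \<le> real n * \<delta>"
    and \<delta>: "0 \<le> \<delta>" and p: "1 \<le> p" "p + 3 \<le> real (2 * r)"
  shows "(\<Sum>i=1..n. \<bar>f i - g i\<bar> powr p)
    \<le> real n * (33 * (6 * a) powr p
        + 16 powr p * real K * real (K + 1) powr p * (real (K + 2) * (8 * 7 ^ K)) * \<delta>)"
proof -
  define q where "q = 2 * r - 1"
  define \<beta> where "\<beta> = real (K + 2) * (8 * 7 ^ K) * \<delta>"
  have \<beta>: "0 \<le> \<beta>" using \<delta> by (simp add: \<beta>_def)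
  have a: "0 < a" by (simp add: a_def)
  have "2 * m \<le> 4 * r * m" using r by (intro mult_right_mono) auto
  then have "2 * m + 1 \<le> K" using K by linarith
  then have MK: "4 / a \<le> real K" by (simp add: a_def)
  define N where "N l = {i\<in>{1..n}. 3 * (real l * a) \<le> \<bar>f i - g i\<bar>}" for l :: nat
  have N: "real (card (N l)) \<le> real n * (16 / real l powr (p + 2) + \<beta>)" if l: "1 \<le> l" for l
  proof -
    define d where "d = real l * a"
    have d: "0 < d" using l a by (simp add: d_def)
    have "N l = {i\<in>{1..n}. f i + 3 * d \<le> g i} \<union> {i\<in>{1..n}. g i + 3 * d \<le> f i}"
      using d by (auto simp: N_def d_def)
    then have "card (N l) \<le> card {i\<in>{1..n}. f i + 3 * d \<le> g i} + card {i\<in>{1..n}. g i + 3 * d \<le> f i}"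
      by (simp add: card_Un_le)
    moreover have "real (card {i\<in>{1..n}. f i + 3 * d \<le> g i})
        \<le> real n * (8 * (a / d) ^ q + (2 / d + 1) * (8 * 7 ^ K) * \<delta>)"
      unfolding a_def q_def by (rule card_large_increments[OF mono range m r K mom d])
    moreover have "real (card {i\<in>{1..n}. g i + 3 * d \<le> f i})
        \<le> real n * (8 * (a / d) ^ q + (2 / d + 1) * (8 * 7 ^ K) * \<delta>)"
      unfolding a_def q_def using mom
      by (intro card_large_increments mono range m r K d) (simp_all add: abs_minus_commute)
    ultimately have "real (card (N l))
        \<le> real n * (16 * (a / d) ^ q + (4 / d + 2) * (8 * 7 ^ K) * \<delta>)"
      by (simp add: algebra_simps)
    also have "\<dots> \<le> real n * (16 / real l powr (p + 2) + \<beta>)"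
    proof (intro mult_left_mono add_mono)
      have "real l powr (p + 2) \<le> real l powr real q"
        using l p r by (intro powr_mono) (auto simp: q_def of_nat_diff)
      then have "real l powr (p + 2) \<le> real l ^ q" using l by (simp add: powr_realpow)
      moreover have "16 * (a / d) ^ q = 16 / real l ^ q" using a by (simp add: d_def power_divide)
      ultimately show "16 * (a / d) ^ q \<le> 16 / real l powr (p + 2)"
        using l by (simp add: divide_left_mono)
      have "a \<le> d" using l a by (simp add: d_def)
      then have "4 / d \<le> 4 / a" using a by (intro divide_left_mono) auto
      then have "4 / d + 2 \<le> real (K + 2)" using MK by simp
      then show "(4 / d + 2) * (8 * 7 ^ K) * \<delta> \<le> \<beta>"
        unfolding \<beta>_def using \<delta> by (intro mult_right_mono) auto
    qed simp
    finally show ?thesis .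
  qed
  define w where "w l = (3 * (real l + 1) * a) powr p" for l :: nat
  have point: "\<bar>f i - g i\<bar> powr p \<le> w 0 + (\<Sum>l=1..K. if i \<in> N l then w l else 0)"
    if i: "i \<in> {1..n}" for i
  proof -
    define x where "x = \<bar>f i - g i\<bar>"
    define l where "l = nat \<lfloor>x / (3 * a)\<rfloor>"
    have x: "0 \<le> x" "x \<le> 2" using range[OF i] by (auto simp: x_def)
    have l: "real l \<le> x / (3 * a)" "x / (3 * a) < real l + 1"
      using x a by (auto simp: l_def)
    then have l': "3 * (real l * a) \<le> x" "x \<le> 3 * (real l + 1) * a"
      using a by (auto simp: field_simps)
    have xw: "x powr p \<le> w l" unfolding w_def using x l' p by (intro powr_mono2) auto
    have w0: "0 \<le> w l" for l by (simp add: w_def)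
    show ?thesis
    proof (cases "l = 0")
      case True
      then show ?thesis using xw w0 by (auto simp: x_def intro!: add_increasing2 sum_nonneg)
    next
      case False
      have "real l \<le> 2 / (3 * a)" using l(1) divide_right_mono[OF x(2), of "3 * a"] a by linarith
      also have "\<dots> \<le> 4 / a" using a by (simp add: divide_simps)
      finally have "l \<in> {1..K}" using MK False by simp
      moreover have "i \<in> N l" using i l' by (simp add: N_def x_def)
      ultimately have "w l \<le> (\<Sum>l=1..K. if i \<in> N l then w l else 0)"
        using member_le_sum[of l "{1..K}" "\<lambda>l. if i \<in> N l then w l else 0"] w0 by auto
      then show ?thesis using xw w0[of 0] by (simp add: x_def)
    qed
  qed
  have "(\<Sum>i=1..n. \<bar>f i - g i\<bar> powr p) \<le> (\<Sum>i=1..n. w 0 + (\<Sum>l=1..K. if i \<in> N l then w l else 0))"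
    by (intro sum_mono point)
  also have "\<dots> = real n * w 0 + (\<Sum>l=1..K. \<Sum>i=1..n. if i \<in> N l then w l else 0)"
    by (simp only: sum.distrib sum.swap[of _ _ "{1..n}"] sum_constant) simp
  also have "\<dots> = real n * w 0 + (\<Sum>l=1..K. real (card (N l)) * w l)"
  proof -
    have "{1..n} \<inter> {i. i \<in> N l} = N l" for l by (auto simp: N_def)
    then show ?thesis by (simp add: sum.If_cases)
  qed
  also have "\<dots> \<le> real n * w 0 + (\<Sum>l=1..K. (real n * (16 / real l powr (p + 2) + \<beta>)) * w l)"
    by (intro add_left_mono sum_mono mult_right_mono N) (auto simp: w_def)
  also have "\<dots> = real n * (w 0 + (\<Sum>l=1..K. (16 / real l powr (p + 2)) * w l + \<beta> * w l))"
    by (simp add: sum_distrib_left distrib_left distrib_right mult.assoc)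
  also have "\<dots> \<le> real n * ((6 * a) powr p + (\<Sum>l=1..K. 16 * (6 * a) powr p * (1 / (real l)\<^sup>2)
      + \<beta> * (16 powr p * real (K + 1) powr p)))"
  proof (intro mult_left_mono add_mono sum_mono)
    show "w 0 \<le> (6 * a) powr p" unfolding w_def using a p by (intro powr_mono2) auto
    fix l assume l: "l \<in> {1..K}"
    have "w l \<le> (real l * (6 * a)) powr p"
      unfolding w_def using l a p by (intro powr_mono2) (auto simp: algebra_simps)
    also have "\<dots> = real l powr p * (6 * a) powr p" using a by (simp add: powr_mult)
    finally have "(16 / real l powr (p + 2)) * w l
        \<le> (16 / real l powr (p + 2)) * (real l powr p * (6 * a) powr p)"
      by (intro mult_left_mono) auto
    also have "\<dots> = 16 * (6 * a) powr p * (1 / (real l)\<^sup>2)"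
      using l by (simp add: powr_add powr_numeral)
    finally show "(16 / real l powr (p + 2)) * w l \<le> 16 * (6 * a) powr p * (1 / (real l)\<^sup>2)" .
    have "3 * a \<le> 16" using m by (simp add: a_def divide_le_eq)
    then have "3 * (real l + 1) * a \<le> 16 * real (K + 1)"
      using l a mult_mono[of "3 * a" 16 "real l + 1" "real (K + 1)"] by (simp add: algebra_simps)
    then have "w l \<le> (16 * real (K + 1)) powr p"
      unfolding w_def using a p by (intro powr_mono2) auto
    also have "\<dots> = 16 powr p * real (K + 1) powr p" by (rule powr_mult)
    finally show "w l \<le> 16 powr p * real (K + 1) powr p" .
  qed (use \<beta> in auto)
  also have "\<dots> = real n * ((6 * a) powr p + (16 * (6 * a) powr p * (\<Sum>l=1..K. 1 / (real l)\<^sup>2)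
      + real K * (\<beta> * (16 powr p * real (K + 1) powr p))))"
    by (simp add: sum.distrib sum_distrib_left)
  also have "\<dots> \<le> real n * ((6 * a) powr p + (16 * (6 * a) powr p * 2
      + real K * (\<beta> * (16 powr p * real (K + 1) powr p))))"
  proof -
    have "(\<Sum>l=1..K. 1 / (real l)\<^sup>2) = (\<Sum>k<K. 1 / (1 + real k)\<^sup>2)"
      by (rule sum.reindex_bij_witness[of _ Suc "\<lambda>l. l - 1"]) auto
    also have "\<dots> \<le> 2" using sum_inverse_squares_nat[of 1 K] by simp
    finally show ?thesis using \<beta> by (intro mult_left_mono add_mono) auto
  qed
  finally show ?thesis by (simp add: \<beta>_def algebra_simps)
qed

text \<open>The order \<open>r\<close> is chosen proportional to \<open>p\<close>, and the resolution \<open>m\<close> as large as the number \<open>K\<close>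
  of available moments permits; the lower bound on \<open>K\<close> ensures \<open>m \<ge> 1\<close>. Then \<open>a \<le> 512 p / K\<close>, and
  the constant is \<open>101376 = 6 \<sqdot> 33 \<sqdot> 512\<close>.\<close>

lemma sum_powr_diff_le_degree:
  fixes f g :: "nat \<Rightarrow> real" and K n :: nat
  assumes mono: "mono_on {1..n} f" "mono_on {1..n} g"
    and range: "\<And>i. i \<in> {1..n} \<Longrightarrow> \<bar>f i\<bar> \<le> 1" "\<And>i. i \<in> {1..n} \<Longrightarrow> \<bar>g i\<bar> \<le> 1"
    and mom: "\<And>k. k \<le> K \<Longrightarrow> \<bar>(\<Sum>i=1..n. f i ^ k) - (\<Sum>i=1..n. g i ^ k)\<bar> \<le> real n * \<delta>"
    and \<delta>: "0 \<le> \<delta>" and p: "1 \<le> p" and K: "4 * (nat \<lceil>p\<rceil> + 2) + 1 \<le> K"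
  shows "(\<Sum>i=1..n. \<bar>f i - g i\<bar> powr p)
    \<le> real n * ((101376 * p / real K) powr p
        + 16 powr p * real K * real (K + 1) powr p * (real (K + 2) * (8 * 7 ^ K)) * \<delta>)"
proof -
  define r where "r = nat \<lceil>p\<rceil> + 2"
  define m where "m = (K - 1) div (4 * r)"
  define a where "a = 16 / real (2 * m + 1)"
  have r: "2 \<le> r" "p + 3 \<le> real (2 * r)" "real r \<le> 4 * p"
    using p by (auto simp: r_def) linarith+
  have K': "4 * r + 1 \<le> K" using K by (simp add: r_def)
  have m: "1 \<le> m" using K' r div_le_mono[of "4 * r" "K - 1" "4 * r"] by (simp add: m_def)
  have "4 * r * m \<le> K - 1" by (simp add: m_def)
  then have mK: "4 * r * m + 1 \<le> K" using K' by linarith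
  have a0: "0 < a" by (simp add: a_def)
  have "K - 1 < 4 * r * (m + 1)"
    using dividend_less_div_times[of "4 * r" "K - 1"] r by (simp add: m_def algebra_simps)
  then have "K \<le> 4 * r * (m + 1)" by linarith
  also have "\<dots> \<le> 8 * r * (2 * m + 1)" by simp
  finally have "real K \<le> 8 * real r * real (2 * m + 1)"
    by (metis of_nat_le_iff of_nat_mult of_nat_numeral)
  then have "a \<le> 128 * real r / real K" using K' by (simp add: a_def field_simps)
  also have "\<dots> \<le> 512 * p / real K" using r K' by (intro divide_right_mono) auto
  finally have aK: "a \<le> 512 * p / real K" .
  have "33 * (6 * a) powr p \<le> 33 powr p * (6 * a) powr p"
    using p powr_mono[of 1 p 33] by (intro mult_right_mono) auto
  also have "\<dots> = (198 * a) powr p" using a0 by (simp flip: powr_mult)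
  also have "\<dots> \<le> (101376 * p / real K) powr p"
    using aK a0 p by (intro powr_mono2) auto
  finally have main: "33 * (6 * a) powr p \<le> (101376 * p / real K) powr p" .
  have "(\<Sum>i=1..n. \<bar>f i - g i\<bar> powr p) \<le> real n * (33 * (6 * a) powr p
        + 16 powr p * real K * real (K + 1) powr p * (real (K + 2) * (8 * 7 ^ K)) * \<delta>)"
    unfolding a_def by (rule sum_powr_diff_le[OF mono range m r(1) mK mom \<delta> p r(2)])
  also have "\<dots> \<le> real n * ((101376 * p / real K) powr p
        + 16 powr p * real K * real (K + 1) powr p * (real (K + 2) * (8 * 7 ^ K)) * \<delta>)"
    by (intro mult_left_mono add_right_mono main) simp
  finally show ?thesis .
qed

section \<open>Unbiased estimation of power moments under known noise\<close>

text \<open>These are the Appell polynomials of the noise: the recursion subtracts from \<open>(v + \<xi>)^k\<close> unbiased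
  estimates of the lower terms of its binomial expansion, so that the expectation of what remains
  is \<open>v^k\<close> when \<open>\<mu>\<close> is the moment sequence of \<open>\<xi>\<close>.\<close>

fun deconv_power :: "(nat \<Rightarrow> real) \<Rightarrow> nat \<Rightarrow> real \<Rightarrow> real" where
  "deconv_power \<mu> k y = y ^ k - (\<Sum>j<k. real (k choose j) * \<mu> (k - j) * deconv_power \<mu> j y)"

declare deconv_power.simps [simp del]

lemma borel_measurable_deconv_power [measurable]: "deconv_power \<mu> k \<in> borel_measurable borel"
proof (induction k rule: less_induct)
  case (less k)
  have "(\<lambda>y. y ^ k - (\<Sum>j<k. real (k choose j) * \<mu> (k - j) * deconv_power \<mu> j y)) \<in> borel_measurable borel"
    using less by (intro borel_measurable_diff borel_measurable_sum borel_measurable_times) auto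
  then show ?case by (subst deconv_power.simps[abs_def]) simp
qed

lemma power_le_fact_exp:
  assumes "0 \<le> (x::real)"
  shows "x ^ k \<le> fact k * exp x" and "1 \<le> k \<Longrightarrow> x ^ k \<le> fact k * (exp x - 1)"
proof -
  have s: "(\<lambda>i. x ^ i / fact i) sums exp x"
    using exp_converges[of x] by (simp add: divide_inverse mult.commute)
  have *: "(\<Sum>i\<in>A. x ^ i / fact i) \<le> exp x" if "finite A" for A
    using sum_le_suminf[OF sums_summable[OF s] that] assms sums_unique[OF s] by simp
  show "x ^ k \<le> fact k * exp x"
    using *[of "{k}"] by (simp add: field_simps)
  show "x ^ k \<le> fact k * (exp x - 1)" if "1 \<le> k"
    using *[of "{0, k}"] that by (simp add: field_simps)
qed

text \<open>Every term of the recursion is at most \<open>fact k * \<rho>^k * exp (\<bar>y\<bar>/\<rho>)\<close> times a power of two, and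
  the powers of two add up to \<open>2^k\<close>.\<close>

lemma abs_deconv_power_le:
  assumes \<mu>: "\<And>j. \<bar>\<mu> j\<bar> \<le> fact j * \<rho> ^ j" and \<rho>: "0 < \<rho>"
  shows "\<bar>deconv_power \<mu> k y\<bar> \<le> fact k * (2 * \<rho>) ^ k * exp (\<bar>y\<bar> / \<rho>)"
proof (induction k rule: less_induct)
  case (less k)
  define E where "E = exp (\<bar>y\<bar> / \<rho>)"
  have E: "0 < E" by (simp add: E_def)
  have "\<bar>y\<bar> ^ k = \<rho> ^ k * (\<bar>y\<bar> / \<rho>) ^ k" using \<rho> by (simp add: power_divide)
  also have "\<dots> \<le> \<rho> ^ k * (fact k * E)"
    unfolding E_def using \<rho> by (intro mult_left_mono power_le_fact_exp) auto
  finally have y: "\<bar>y\<bar> ^ k \<le> fact k * \<rho> ^ k * E" by (simp add: algebra_simps)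
  have t: "\<bar>real (k choose j) * \<mu> (k - j) * deconv_power \<mu> j y\<bar> \<le> fact k * \<rho> ^ k * E * 2 ^ j"
    if j: "j < k" for j
  proof -
    have "\<bar>real (k choose j) * \<mu> (k - j) * deconv_power \<mu> j y\<bar>
        \<le> real (k choose j) * (fact (k - j) * \<rho> ^ (k - j)) * (fact j * (2 * \<rho>) ^ j * E)"
      unfolding abs_mult E_def using less[OF j] \<mu>[of "k - j"] \<rho>
      by (intro mult_mono) auto
    also have "\<dots> = (fact j * fact (k - j) * real (k choose j)) * (\<rho> ^ (k - j) * \<rho> ^ j) * E * 2 ^ j"
      by (simp add: power_mult_distrib)
    also have "fact j * fact (k - j) * real (k choose j) = fact k"
      using binomial_fact_lemma[of j k] j by (metis less_imp_le of_nat_fact of_nat_mult)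
    also have "\<rho> ^ (k - j) * \<rho> ^ j = \<rho> ^ k"
      using j by (simp flip: power_add)
    finally show ?thesis .
  qed
  have "\<bar>deconv_power \<mu> k y\<bar> \<le> \<bar>y\<bar> ^ k + (\<Sum>j<k. \<bar>real (k choose j) * \<mu> (k - j) * deconv_power \<mu> j y\<bar>)"
    by (subst deconv_power.simps, rule order.trans[OF abs_triangle_ineq4])
       (auto intro!: add_mono sum_abs simp: power_abs)
  also have "\<dots> \<le> fact k * \<rho> ^ k * E + (\<Sum>j<k. fact k * \<rho> ^ k * E * 2 ^ j)"
    by (intro add_mono sum_mono y t) simp
  also have "\<dots> = fact k * \<rho> ^ k * E * (1 + (\<Sum>j<k. 2 ^ j))"
    by (simp add: sum_distrib_left distrib_left)
  also have "1 + (\<Sum>j<k. 2 ^ j) = (2 ^ k :: real)"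
    by (induction k) auto
  finally show ?case by (simp add: E_def power_mult_distrib algebra_simps)
qed

definition noise_moment :: "real measure \<Rightarrow> nat \<Rightarrow> real" where
  "noise_moment D j = (\<integral>u. u ^ j \<partial>D)"

text \<open>A noise law with \<open>psi1_norm\<close> at most \<open>\<tau>\<close>, the infimum in the norm being replaced by an
  admissible value.\<close>

locale exp_noise = prob_space D for D :: "real measure" +
  fixes \<tau> :: real
  assumes sets_D [measurable_cong]: "sets D = sets borel"
    and \<tau>_pos: "0 < \<tau>"
    and exp_moment: "(\<integral>\<^sup>+u. ennreal (exp (\<bar>u\<bar> / \<tau>) - 1) \<partial>D) \<le> 1"
begin

lemma integrable_exp_minus_1: "integrable D (\<lambda>u. exp (\<bar>u\<bar> / \<tau>) - 1)"
  and integral_exp_minus_1: "(\<integral>u. exp (\<bar>u\<bar> / \<tau>) - 1 \<partial>D) \<le> 1"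
proof -
  show i: "integrable D (\<lambda>u. exp (\<bar>u\<bar> / \<tau>) - 1)"
    using \<tau>_pos le_less_trans[OF exp_moment] by (intro integrableI_nonneg) auto
  have "ennreal (\<integral>u. exp (\<bar>u\<bar> / \<tau>) - 1 \<partial>D) \<le> ennreal 1"
    using nn_integral_eq_integral[OF i] \<tau>_pos exp_moment by simp
  then show "(\<integral>u. exp (\<bar>u\<bar> / \<tau>) - 1 \<partial>D) \<le> 1" by (subst (asm) ennreal_le_iff) auto
qed

lemma integrable_exp: "integrable D (\<lambda>u. exp (\<bar>u\<bar> / \<tau>))"
  and integral_exp: "(\<integral>u. exp (\<bar>u\<bar> / \<tau>) \<partial>D) \<le> 2"
proof -
  have eq: "exp (\<bar>u\<bar> / \<tau>) = (exp (\<bar>u\<bar> / \<tau>) - 1) + 1" for u by simp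
  show "integrable D (\<lambda>u. exp (\<bar>u\<bar> / \<tau>))"
    by (subst eq) (intro Bochner_Integration.integrable_add integrable_exp_minus_1 integrable_const)
  show "(\<integral>u. exp (\<bar>u\<bar> / \<tau>) \<partial>D) \<le> 2"
    by (subst eq, subst Bochner_Integration.integral_add)
       (use integrable_exp_minus_1 integral_exp_minus_1 prob_space in auto)
qed

lemma integrable_power: "integrable D (\<lambda>u. u ^ j)"
proof (rule Bochner_Integration.integrable_bound)
  show "integrable D (\<lambda>u. fact j * \<tau> ^ j * exp (\<bar>u\<bar> / \<tau>))"
    by (intro integrable_mult_right integrable_exp)
  show "AE u in D. norm (u ^ j) \<le> norm (fact j * \<tau> ^ j * exp (\<bar>u\<bar> / \<tau>))"
  proof (rule AE_I2)
    fix u :: real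
    have "\<bar>u\<bar> ^ j = \<tau> ^ j * (\<bar>u\<bar> / \<tau>) ^ j" using \<tau>_pos by (simp add: power_divide)
    also have "\<dots> \<le> \<tau> ^ j * (fact j * exp (\<bar>u\<bar> / \<tau>))"
      using \<tau>_pos by (intro mult_left_mono power_le_fact_exp) auto
    finally show "norm (u ^ j) \<le> norm (fact j * \<tau> ^ j * exp (\<bar>u\<bar> / \<tau>))"
      using \<tau>_pos by (simp add: power_abs abs_mult algebra_simps)
  qed
qed simp

lemma abs_noise_moment_le: "\<bar>noise_moment D j\<bar> \<le> fact j * \<tau> ^ j"
proof (cases "j = 0")
  case True
  then show ?thesis by (simp add: noise_moment_def prob_space)
next
  case False
  have "\<bar>noise_moment D j\<bar> \<le> (\<integral>u. \<bar>u ^ j\<bar> \<partial>D)"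
    unfolding noise_moment_def by (rule integral_abs_bound)
  also have "\<dots> \<le> (\<integral>u. fact j * \<tau> ^ j * (exp (\<bar>u\<bar> / \<tau>) - 1) \<partial>D)"
  proof (rule integral_mono)
    show "integrable D (\<lambda>u. \<bar>u ^ j\<bar>)" using integrable_power by (rule integrable_abs)
    show "integrable D (\<lambda>u. fact j * \<tau> ^ j * (exp (\<bar>u\<bar> / \<tau>) - 1))"
      by (intro integrable_mult_right integrable_exp_minus_1)
    fix u :: real
    have "\<bar>u\<bar> ^ j = \<tau> ^ j * (\<bar>u\<bar> / \<tau>) ^ j" using \<tau>_pos by (simp add: power_divide)
    also have "\<dots> \<le> \<tau> ^ j * (fact j * (exp (\<bar>u\<bar> / \<tau>) - 1))"
      using \<tau>_pos False by (intro mult_left_mono power_le_fact_exp) auto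
    finally show "\<bar>u ^ j\<bar> \<le> fact j * \<tau> ^ j * (exp (\<bar>u\<bar> / \<tau>) - 1)"
      by (simp add: power_abs algebra_simps)
  qed
  also have "\<dots> \<le> fact j * \<tau> ^ j * 1"
    unfolding integral_mult_right_zero
    using integral_exp_minus_1 \<tau>_pos by (intro mult_left_mono) auto
  finally show ?thesis by simp
qed

text \<open>The growth bound is used at scale \<open>2\<tau>\<close> because squaring doubles the exponent, and the noise only
  has an exponential moment at scale \<open>\<tau>\<close>.\<close>

lemma deconv_power_square_le:
  "(deconv_power (noise_moment D) k (v + u))\<^sup>2 \<le> (fact k * (4 * \<tau>) ^ k)\<^sup>2 * exp (\<bar>v\<bar> / \<tau>) * exp (\<bar>u\<bar> / \<tau>)"
proof -
  have \<mu>: "\<bar>noise_moment D j\<bar> \<le> fact j * (2 * \<tau>) ^ j" for j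
    using \<tau>_pos by (intro order.trans[OF abs_noise_moment_le] mult_left_mono power_mono) auto
  have "\<bar>deconv_power (noise_moment D) k (v + u)\<bar>
      \<le> fact k * (2 * (2 * \<tau>)) ^ k * exp (\<bar>v + u\<bar> / (2 * \<tau>))"
    using \<tau>_pos by (intro abs_deconv_power_le \<mu>) auto
  then have "(deconv_power (noise_moment D) k (v + u))\<^sup>2
      \<le> (fact k * (2 * (2 * \<tau>)) ^ k * exp (\<bar>v + u\<bar> / (2 * \<tau>)))\<^sup>2"
    by (metis abs_ge_zero power2_abs power_mono)
  also have "\<dots> = (fact k * (4 * \<tau>) ^ k)\<^sup>2 * exp (\<bar>v + u\<bar> / \<tau>)"
    by (simp add: power_mult_distrib flip: exp_double)
  also have "exp (\<bar>v + u\<bar> / \<tau>) \<le> exp (\<bar>v\<bar> / \<tau>) * exp (\<bar>u\<bar> / \<tau>)"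
    using \<tau>_pos by (simp add: divide_right_mono flip: exp_add add_divide_distrib)
  finally show ?thesis by (simp add: mult.assoc mult_left_mono)
qed

lemma integrable_deconv_power_square: "integrable D (\<lambda>u. (deconv_power (noise_moment D) k (v + u))\<^sup>2)"
proof (rule Bochner_Integration.integrable_bound)
  show "integrable D (\<lambda>u. (fact k * (4 * \<tau>) ^ k)\<^sup>2 * exp (\<bar>v\<bar> / \<tau>) * exp (\<bar>u\<bar> / \<tau>))"
    by (intro integrable_mult_right integrable_exp)
  show "AE u in D. norm ((deconv_power (noise_moment D) k (v + u))\<^sup>2)
      \<le> norm ((fact k * (4 * \<tau>) ^ k)\<^sup>2 * exp (\<bar>v\<bar> / \<tau>) * exp (\<bar>u\<bar> / \<tau>))"
    using deconv_power_square_le by (intro AE_I2) (simp add: abs_mult)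
qed simp

lemma integral_deconv_power_square_le:
  "(\<integral>u. (deconv_power (noise_moment D) k (v + u))\<^sup>2 \<partial>D) \<le> 2 * exp (\<bar>v\<bar> / \<tau>) * (fact k * (4 * \<tau>) ^ k)\<^sup>2"
proof -
  have "(\<integral>u. (deconv_power (noise_moment D) k (v + u))\<^sup>2 \<partial>D)
      \<le> (\<integral>u. (fact k * (4 * \<tau>) ^ k)\<^sup>2 * exp (\<bar>v\<bar> / \<tau>) * exp (\<bar>u\<bar> / \<tau>) \<partial>D)"
    by (intro integral_mono integrable_deconv_power_square integrable_mult_right integrable_exp
        deconv_power_square_le)
  also have "\<dots> = (fact k * (4 * \<tau>) ^ k)\<^sup>2 * exp (\<bar>v\<bar> / \<tau>) * (\<integral>u. exp (\<bar>u\<bar> / \<tau>) \<partial>D)"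
    by simp
  also have "\<dots> \<le> (fact k * (4 * \<tau>) ^ k)\<^sup>2 * exp (\<bar>v\<bar> / \<tau>) * 2"
    by (intro mult_left_mono integral_exp) auto
  finally show ?thesis by (simp add: algebra_simps)
qed

lemma integrable_deconv_power: "integrable D (\<lambda>u. deconv_power (noise_moment D) k (v + u))"
  by (rule square_integrable_imp_integrable[OF _ integrable_deconv_power_square]) simp

lemma integral_deconv_power: "(\<integral>u. deconv_power (noise_moment D) k (v + u) \<partial>D) = v ^ k"
proof (induction k rule: less_induct)
  case (less k)
  have ip: "integrable D (\<lambda>u. (v + u) ^ k)"
    unfolding binomial_ring
    by (intro Bochner_Integration.integrable_sum integrable_mult_right integrable_power)
  have "(\<integral>u. (v + u) ^ k \<partial>D) = (\<Sum>j\<le>k. real (k choose j) * v ^ j * noise_moment D (k - j))"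
    unfolding binomial_ring noise_moment_def
    by (subst Bochner_Integration.integral_sum) (auto intro!: integrable_mult_right integrable_power)
  also have "{..k} = insert k {..<k}" by auto
  finally have "(\<integral>u. (v + u) ^ k \<partial>D)
      = v ^ k + (\<Sum>j<k. real (k choose j) * v ^ j * noise_moment D (k - j))"
    by (simp add: noise_moment_def prob_space)
  moreover have "(\<integral>u. deconv_power (noise_moment D) k (v + u) \<partial>D) = (\<integral>u. (v + u) ^ k \<partial>D)
      - (\<Sum>j<k. real (k choose j) * noise_moment D (k - j) * (\<integral>u. deconv_power (noise_moment D) j (v + u) \<partial>D))"
    by (subst deconv_power.simps)
       (simp add: ip integrable_deconv_power Bochner_Integration.integral_diff
         Bochner_Integration.integral_sum Bochner_Integration.integrable_sum)
  moreover have "(\<Sum>j<k. real (k choose j) * noise_moment D (k - j) * (\<integral>u. deconv_power (noise_moment D) j (v + u) \<partial>D))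
      = (\<Sum>j<k. real (k choose j) * v ^ j * noise_moment D (k - j))"
    using less by (intro sum.cong) auto
  ultimately show ?case by simp
qed

lemma variance_deconv_power_le:
  "integrable D (\<lambda>u. (deconv_power (noise_moment D) k (v + u) - v ^ k)\<^sup>2)"
  "(\<integral>u. (deconv_power (noise_moment D) k (v + u) - v ^ k)\<^sup>2 \<partial>D) \<le> 2 * exp (\<bar>v\<bar> / \<tau>) * (fact k * (4 * \<tau>) ^ k)\<^sup>2"
proof -
  let ?A = "\<lambda>u. deconv_power (noise_moment D) k (v + u)"
  have eq: "(?A u - v ^ k)\<^sup>2 = (?A u)\<^sup>2 - 2 * v ^ k * ?A u + (v ^ k)\<^sup>2" for u
    by (simp add: power2_diff)
  note int = integrable_deconv_power_square integrable_deconv_power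
  show "integrable D (\<lambda>u. (?A u - v ^ k)\<^sup>2)"
    unfolding eq by (intro Bochner_Integration.integrable_add Bochner_Integration.integrable_diff
        integrable_mult_right integrable_const int)
  have "(\<integral>u. (?A u - v ^ k)\<^sup>2 \<partial>D) = (\<integral>u. (?A u)\<^sup>2 \<partial>D) - 2 * v ^ k * v ^ k + (v ^ k)\<^sup>2"
    unfolding eq using int
    by (simp add: integral_deconv_power prob_space)
  also have "\<dots> \<le> (\<integral>u. (?A u)\<^sup>2 \<partial>D)" by (simp add: power2_eq_square)
  also have "\<dots> \<le> 2 * exp (\<bar>v\<bar> / \<tau>) * (fact k * (4 * \<tau>) ^ k)\<^sup>2"
    by (rule integral_deconv_power_square_le)
  finally show "(\<integral>u. (?A u - v ^ k)\<^sup>2 \<partial>D) \<le> 2 * exp (\<bar>v\<bar> / \<tau>) * (fact k * (4 * \<tau>) ^ k)\<^sup>2" .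
qed

end

text \<open>Expanding the square, a product of two summands is a product over all coordinates whose factors
  are one except at two places, so Fubini applies and the centred mixed terms vanish.\<close>

lemma (in product_prob_space) second_moment_independent_sum:
  fixes h :: "'i \<Rightarrow> 'a \<Rightarrow> real"
  assumes I: "finite I" and h: "\<And>i. i \<in> I \<Longrightarrow> integrable (M i) (h i)"
    and h2: "\<And>i. i \<in> I \<Longrightarrow> integrable (M i) (\<lambda>u. (h i u)\<^sup>2)"
    and h0: "\<And>i. i \<in> I \<Longrightarrow> (\<integral>u. h i u \<partial>M i) = 0"
  shows "integrable (PiM I M) (\<lambda>\<xi>. (\<Sum>i\<in>I. h i (\<xi> i))\<^sup>2)"
    and "(\<integral>\<xi>. (\<Sum>i\<in>I. h i (\<xi> i))\<^sup>2 \<partial>PiM I M) = (\<Sum>i\<in>I. \<integral>u. (h i u)\<^sup>2 \<partial>M i)"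
proof -
  \<comment> \<open>The factor at coordinate \<open>l\<close> of the product of summands \<open>i\<close> and \<open>j\<close>, written so that \<open>i = j\<close>
    is covered as well.\<close>
  define g where "g i j l u = (if l = i then h i u else 1) * (if l = j then h j u else 1)" for i j l u
  have gint: "integrable (M l) (g i j l)" if "i \<in> I" "j \<in> I" "l \<in> I" for i j l
    using h h2 that unfolding g_def power2_eq_square by (cases "l = i"; cases "l = j") auto
  have prod: "h i (\<xi> i) * h j (\<xi> j) = (\<Prod>l\<in>I. g i j l (\<xi> l))" if "i \<in> I" "j \<in> I" for i j \<xi>
    using that I by (simp add: g_def prod.distrib prod.delta')
  have sq: "(\<Sum>i\<in>I. h i (\<xi> i))\<^sup>2 = (\<Sum>i\<in>I. \<Sum>j\<in>I. \<Prod>l\<in>I. g i j l (\<xi> l))" for \<xi>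
    unfolding power2_eq_square sum_product by (intro sum.cong prod refl)
  have pint: "integrable (PiM I M) (\<lambda>\<xi>. \<Prod>l\<in>I. g i j l (\<xi> l))" if "i \<in> I" "j \<in> I" for i j
    using that by (intro product_integrable_prod I gint)
  show "integrable (PiM I M) (\<lambda>\<xi>. (\<Sum>i\<in>I. h i (\<xi> i))\<^sup>2)"
    unfolding sq by (intro Bochner_Integration.integrable_sum pint)
  have val: "(\<integral>\<xi>. (\<Prod>l\<in>I. g i j l (\<xi> l)) \<partial>PiM I M) = (if i = j then \<integral>u. (h i u)\<^sup>2 \<partial>M i else 0)"
    if ij: "i \<in> I" "j \<in> I" for i j
  proof -
    have "(\<integral>\<xi>. (\<Prod>l\<in>I. g i j l (\<xi> l)) \<partial>PiM I M) = (\<Prod>l\<in>I. \<integral>u. g i j l u \<partial>M l)"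
      using ij by (intro product_integral_prod I gint)
    also have "\<dots> = (if i = j then \<integral>u. (h i u)\<^sup>2 \<partial>M i else 0)"
    proof (cases "i = j")
      case True
      have "(\<Prod>l\<in>I. \<integral>u. g i j l u \<partial>M l) = (\<Prod>l\<in>I. if l = i then \<integral>u. (h i u)\<^sup>2 \<partial>M i else 1)"
        using True M.prob_space by (intro prod.cong) (auto simp: g_def power2_eq_square)
      then show ?thesis using True I ij by (simp add: prod.delta)
    next
      case False
      then have "(\<integral>u. g i j i u \<partial>M i) = 0" using h0[OF ij(1)] by (simp add: g_def)
      then show ?thesis using False I ij by (auto simp: prod_zero_iff)
    qed
    finally show ?thesis .
  qed
  have "(\<integral>\<xi>. (\<Sum>i\<in>I. h i (\<xi> i))\<^sup>2 \<partial>PiM I M)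
      = (\<Sum>i\<in>I. \<Sum>j\<in>I. \<integral>\<xi>. (\<Prod>l\<in>I. g i j l (\<xi> l)) \<partial>PiM I M)"
    unfolding sq using pint by (simp add: Bochner_Integration.integral_sum Bochner_Integration.integrable_sum)
  also have "\<dots> = (\<Sum>i\<in>I. \<Sum>j\<in>I. if i = j then \<integral>u. (h i u)\<^sup>2 \<partial>M i else 0)"
    by (intro sum.cong val refl)
  also have "\<dots> = (\<Sum>i\<in>I. \<integral>u. (h i u)\<^sup>2 \<partial>M i)"
    using I by (simp add: sum.delta)
  finally show "(\<integral>\<xi>. (\<Sum>i\<in>I. h i (\<xi> i))\<^sup>2 \<partial>PiM I M) = (\<Sum>i\<in>I. \<integral>u. (h i u)\<^sup>2 \<partial>M i)" .
qed

context exp_noise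
begin

lemma measure_moment_error_le:
  fixes n k :: nat and v :: "nat \<Rightarrow> real"
  assumes v: "\<And>i. i \<in> {1..n} \<Longrightarrow> \<bar>v i\<bar> \<le> V" and n: "1 \<le> n" and \<eta>: "0 < \<eta>"
  shows "measure (\<Pi>\<^sub>M i\<in>{1..n}. D) {\<xi>\<in>space (\<Pi>\<^sub>M i\<in>{1..n}. D).
      real n * \<eta> \<le> \<bar>(\<Sum>i=1..n. deconv_power (noise_moment D) k (v i + \<xi> i)) - (\<Sum>i=1..n. v i ^ k)\<bar>}
    \<le> 2 * exp (V / \<tau>) * (fact k * (4 * \<tau>) ^ k)\<^sup>2 / (real n * \<eta>\<^sup>2)"
proof -
  let ?P = "\<Pi>\<^sub>M i\<in>{1..n}. D"
  define h where "h i u = deconv_power (noise_moment D) k (v i + u) - v i ^ k" for i u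
  define W where "W = 2 * exp (V / \<tau>) * (fact k * (4 * \<tau>) ^ k)\<^sup>2"
  have h: "integrable D (h i)" "integrable D (\<lambda>u. (h i u)\<^sup>2)" "(\<integral>u. h i u \<partial>D) = 0" for i
    unfolding h_def using variance_deconv_power_le(1)
    by (auto simp: integrable_deconv_power integral_deconv_power prob_space)
  have hW: "(\<integral>u. (h i u)\<^sup>2 \<partial>D) \<le> W" if "i \<in> {1..n}" for i
  proof -
    have "(\<integral>u. (h i u)\<^sup>2 \<partial>D) \<le> 2 * exp (\<bar>v i\<bar> / \<tau>) * (fact k * (4 * \<tau>) ^ k)\<^sup>2"
      unfolding h_def by (rule variance_deconv_power_le)
    also have "\<dots> \<le> W"
      unfolding W_def using v[OF that] \<tau>_pos by (intro mult_right_mono mult_left_mono) (auto simp: divide_right_mono)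
    finally show ?thesis .
  qed
  interpret product_prob_space "\<lambda>_. D" "{1..n}" by unfold_locales
  have sq: "integrable ?P (\<lambda>\<xi>. (\<Sum>i\<in>{1..n}. h i (\<xi> i))\<^sup>2)"
    "(\<integral>\<xi>. (\<Sum>i\<in>{1..n}. h i (\<xi> i))\<^sup>2 \<partial>?P) = (\<Sum>i\<in>{1..n}. \<integral>u. (h i u)\<^sup>2 \<partial>D)"
    using second_moment_independent_sum[of h] h by auto
  have "{\<xi>\<in>space ?P.
      real n * \<eta> \<le> \<bar>(\<Sum>i=1..n. deconv_power (noise_moment D) k (v i + \<xi> i)) - (\<Sum>i=1..n. v i ^ k)\<bar>}
      = {\<xi>\<in>space ?P. (\<Sum>i\<in>{1..n}. h i (\<xi> i))\<^sup>2 \<ge> (real n * \<eta>)\<^sup>2}"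
    using \<eta> by (auto simp: h_def sum_subtractf abs_le_square_iff[symmetric])
  also have "measure ?P \<dots> \<le> (\<integral>\<xi>. (\<Sum>i\<in>{1..n}. h i (\<xi> i))\<^sup>2 \<partial>?P) / (real n * \<eta>)\<^sup>2"
    using n \<eta> by (intro integral_Markov_inequality_measure[where A = "{}"] sq) auto
  also have "\<dots> \<le> (\<Sum>i\<in>{1..n}. W) / (real n * \<eta>)\<^sup>2"
    unfolding sq(2) by (intro divide_right_mono sum_mono hW) auto
  also have "\<dots> = W / (real n * \<eta>\<^sup>2)"
    using n by (simp add: power2_eq_square)
  finally show ?thesis by (simp add: W_def)
qed

end

section \<open>The estimator\<close>

text \<open>Candidates for the normalised values \<open>f (x i) / V\<close>. Restricting them to a finite grid makes the
  choice of a candidate with matching moments measurable, since the first one in an enumeration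
  can be taken. The mesh \<open>1/n\<close> is far below the accuracy that is aimed at.\<close>

definition grid_sequences :: "nat \<Rightarrow> (nat \<Rightarrow> real) set" where
  "grid_sequences n = {c \<in> {1..n} \<rightarrow>\<^sub>E (\<lambda>j. real_of_int j / real n) ` {- int n..int n}. mono_on {1..n} c}"

abbreviation grid_sequence :: "nat \<Rightarrow> nat \<Rightarrow> nat \<Rightarrow> real" where
  "grid_sequence n \<equiv> from_nat_into (grid_sequences n)"

definition fits_moments ::
  "real \<Rightarrow> real measure \<Rightarrow> nat \<Rightarrow> nat \<Rightarrow> real \<Rightarrow> real multiset \<Rightarrow> nat \<Rightarrow> bool" where
  "fits_moments V D n K \<epsilon> Y j \<longleftrightarrow> (\<forall>k\<le>K.
     \<bar>(\<Sum>i=1..n. grid_sequence n j i ^ k) - (\<Sum>u\<in>#Y. deconv_power (noise_moment D) k u) / V ^ k\<bar>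
       \<le> real n * (2 * \<epsilon>))"

text \<open>The chosen sequence is turned into a function through the rank of \<open>t\<close> among the design points,
  which can be read off their multiset. Any index whose moments are as accurate as those of the
  truth will do, so no dependence on \<open>p\<close> enters.\<close>

definition moment_estimator :: "real \<Rightarrow> real measure \<Rightarrow> nat \<Rightarrow> nat \<Rightarrow> real \<Rightarrow> estimator" where
  "moment_estimator V D n K \<epsilon> X Y t =
     V * grid_sequence n (LEAST j. fits_moments V D n K \<epsilon> Y j) (size (filter_mset (\<lambda>u. u \<le> t) X))"

lemma sum_mset_unlabelled: "(\<Sum>u\<in>#unlabelled n z. g u) = (\<Sum>i=1..n. g (z i))" for g :: "real \<Rightarrow> real"
  by (simp add: unlabelled_def sum_unfold_sum_mset multiset.map_comp o_def)

lemma size_filter_unlabelled: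
  "size (filter_mset (\<lambda>u. u \<le> t) (unlabelled n z)) = (\<Sum>i=1..n. if z i \<le> t then 1 else 0)"
proof -
  have "size (filter_mset (\<lambda>u. u \<le> t) (unlabelled n z)) = card {i\<in>{1..n}. z i \<le> t}"
    by (simp add: unlabelled_def filter_mset_image_mset)
  then show ?thesis by (simp add: sum.If_cases Int_def)
qed

lemma rank_of_design_point:
  assumes "design n x" "i \<in> {1..n}"
  shows "size (filter_mset (\<lambda>u. u \<le> x i) (unlabelled n x)) = i"
proof -
  have "x j \<le> x i \<longleftrightarrow> j \<le> i" if "j \<in> {1..n}" for j
    using assms that strict_mono_on_less_eq[of "{1..n}" x j i] by (simp add: design_def)
  then have "{j\<in>{1..n}. x j \<le> x i} = {1..i}" using assms by auto
  then show ?thesis by (simp add: unlabelled_def filter_mset_image_mset)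
qed

lemma measurable_moment_estimator: "measurable_estimator n (moment_estimator V D n K \<epsilon>)"
  unfolding measurable_estimator_def
proof
  fix t :: real
  let ?M = "(\<Pi>\<^sub>M i\<in>{1..n}. (borel :: real measure)) \<Otimes>\<^sub>M (\<Pi>\<^sub>M i\<in>{1..n}. (borel :: real measure))"
  define L where "L \<omega> = (LEAST j. fits_moments V D n K \<epsilon> (unlabelled n (snd \<omega>)) j)" for \<omega> :: "(nat \<Rightarrow> real) \<times> (nat \<Rightarrow> real)"
  define R where "R \<omega> = (\<Sum>i=1..n. if fst \<omega> i \<le> t then 1 else (0::nat))" for \<omega> :: "(nat \<Rightarrow> real) \<times> (nat \<Rightarrow> real)"
  have [measurable]: "(\<lambda>\<omega>. snd \<omega> i) \<in> borel_measurable ?M" "(\<lambda>\<omega>. fst \<omega> i) \<in> borel_measurable ?M"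
    if "i \<in> {1..n}" for i
    using that by (auto intro!: measurable_compose[OF measurable_snd] measurable_compose[OF measurable_fst]
        measurable_component_singleton)
  have L: "L \<in> measurable ?M (count_space UNIV)"
    unfolding L_def fits_moments_def sum_mset_unlabelled
    by (intro measurable_Least) measurable
  have R: "R \<in> measurable ?M (count_space UNIV)"
    unfolding R_def by (intro measurable_sum_nat) measurable
  have "(\<lambda>\<omega>. V * grid_sequence n (L \<omega>) (R \<omega>)) \<in> borel_measurable ?M"
    by (rule measurable_compose_countable[OF measurable_compose_countable[OF _ R] L]) simp
  also have "(\<lambda>\<omega>. V * grid_sequence n (L \<omega>) (R \<omega>))
      = (\<lambda>(x, y). moment_estimator V D n K \<epsilon> (unlabelled n x) (unlabelled n y) t)"
    by (auto simp: L_def R_def moment_estimator_def size_filter_unlabelled)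
  finally show "(\<lambda>(x, y). moment_estimator V D n K \<epsilon> (unlabelled n x) (unlabelled n y) t) \<in> borel_measurable ?M" .
qed

lemma grid_sequences_approximate:
  assumes f: "mono_on {1..n} f" "\<And>i. i \<in> {1..n} \<Longrightarrow> \<bar>f i\<bar> \<le> 1" and n: "1 \<le> n"
  obtains c where "c \<in> grid_sequences n" "\<And>i. i \<in> {1..n} \<Longrightarrow> \<bar>f i - c i\<bar> \<le> 1 / real n"
proof
  define c where "c = (\<lambda>i\<in>{1..n}. real_of_int \<lfloor>real n * f i\<rfloor> / real n)"
  have "\<lfloor>real n * f i\<rfloor> \<in> {- int n..int n}" if "i \<in> {1..n}" for i
  proof -
    have "\<bar>real n * f i\<bar> \<le> real n" using f(2)[OF that] by (simp add: abs_mult mult_left_le)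
    then have "real_of_int (- int n) \<le> real n * f i" "real n * f i \<le> real_of_int (int n)" by auto
    then show ?thesis by (auto simp: le_floor_iff floor_le_iff)
  qed
  moreover have "mono_on {1..n} c"
    by (intro monotone_onI)
       (auto simp: c_def intro!: divide_right_mono floor_mono mult_left_mono monotone_onD[OF f(1)])
  ultimately show "c \<in> grid_sequences n"
    by (auto simp: grid_sequences_def c_def)
  show "\<bar>f i - c i\<bar> \<le> 1 / real n" if "i \<in> {1..n}" for i
  proof -
    have "f i - c i = (real n * f i - real_of_int \<lfloor>real n * f i\<rfloor>) / real n"
      using that n by (simp add: c_def diff_divide_distrib)
    moreover have "\<bar>real n * f i - real_of_int \<lfloor>real n * f i\<rfloor>\<bar> \<le> 1" by linarith
    ultimately show ?thesis using n by (simp add: abs_divide divide_right_mono)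
  qed
qed

lemma finite_grid_sequences: "finite (grid_sequences n)"
  unfolding grid_sequences_def by (intro finite_Collect_conjI disjI1) (simp add: finite_PiE)

lemma grid_sequences_not_empty: "1 \<le> n \<Longrightarrow> grid_sequences n \<noteq> {}"
  using grid_sequences_approximate[of n "\<lambda>_. 0"] by (auto simp: mono_on_def)

lemma grid_sequence:
  assumes "1 \<le> n"
  shows "mono_on {1..n} (grid_sequence n j)" "i \<in> {1..n} \<Longrightarrow> \<bar>grid_sequence n j i\<bar> \<le> 1"
proof -
  have *: "grid_sequence n j \<in> grid_sequences n"
    by (rule from_nat_into) (rule grid_sequences_not_empty[OF assms])
  then show "mono_on {1..n} (grid_sequence n j)" by (simp add: grid_sequences_def)
  show "\<bar>grid_sequence n j i\<bar> \<le> 1" if "i \<in> {1..n}"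
  proof -
    have "grid_sequence n j i \<in> (\<lambda>j. real_of_int j / real n) ` {- int n..int n}"
      using * that by (auto simp: grid_sequences_def PiE_def Pi_def)
    then obtain l where l: "grid_sequence n j i = real_of_int l / real n" "l \<in> {- int n..int n}"
      by blast
    then have "\<bar>real_of_int l\<bar> \<le> real n" by auto
    then show ?thesis using l(1) assms by (simp add: abs_divide divide_le_eq)
  qed
qed

section \<open>A risk bound for fixed sample size\<close>

definition matching_error :: "nat \<Rightarrow> real \<Rightarrow> real \<Rightarrow> real" where
  "matching_error K p \<delta> = (101376 * p / real K) powr p
     + 16 powr p * real K * real (K + 1) powr p * (real (K + 2) * (8 * 7 ^ K)) * \<delta>"

text \<open>If all empirical moments are accurate to \<open>\<epsilon>\<close>, the truth rounded to the grid fits within \<open>2\<epsilon>\<close>, so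
  a fitting index exists; the moments of the selected sequence are then within \<open>3\<epsilon>\<close> of those of
  the truth, and both are monotone.\<close>

lemma emp_norm_moment_estimator_le:
  assumes V: "0 < V" and n: "1 \<le> n" and x: "design n x" and f: "f \<in> mono_class V" and p: "1 \<le> p"
    and K: "4 * (nat \<lceil>p\<rceil> + 2) + 1 \<le> K" and \<epsilon>: "real K \<le> real n * \<epsilon>"
    and good: "\<And>k. k \<le> K \<Longrightarrow>
      \<bar>(\<Sum>i=1..n. deconv_power (noise_moment D) k (y i)) - (\<Sum>i=1..n. f (x i) ^ k)\<bar> \<le> real n * (\<epsilon> * V ^ k)"
  shows "emp_norm_pow n x p (\<lambda>t. f t - moment_estimator V D n K \<epsilon> (unlabelled n x) (unlabelled n y) t)
    \<le> V powr p * matching_error K p (3 * \<epsilon>)"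
proof -
  define g where "g i = f (x i) / V" for i
  have x01: "x i \<in> {0..1}" if "i \<in> {1..n}" for i using x that by (auto simp: design_def)
  have g: "mono_on {1..n} g" "\<And>i. i \<in> {1..n} \<Longrightarrow> \<bar>g i\<bar> \<le> 1"
  proof -
    have "g i \<le> g j" if ij: "i \<in> {1..n}" "j \<in> {1..n}" "i \<le> j" for i j
    proof -
      have "x i \<le> x j"
        using x ij strict_mono_on_leD[of "{1..n}" x i j] by (simp add: design_def)
      then have "f (x i) \<le> f (x j)"
        using f x01[OF ij(1)] x01[OF ij(2)] monotone_onD[of "{0..1}" "(\<le>)" "(\<le>)" f "x i" "x j"]
        by (simp add: mono_class_def)
      then show ?thesis using V by (simp add: g_def divide_right_mono)
    qed
    then show "mono_on {1..n} g" unfolding monotone_on_def by blast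
    show "\<bar>g i\<bar> \<le> 1" if "i \<in> {1..n}" for i
      using f x01[OF that] V by (simp add: g_def mono_class_def abs_divide)
  qed
  define m where "m k = (\<Sum>u\<in>#unlabelled n y. deconv_power (noise_moment D) k u) / V ^ k" for k
  have m: "\<bar>m k - (\<Sum>i=1..n. g i ^ k)\<bar> \<le> real n * \<epsilon>" if "k \<le> K" for k
  proof -
    define X where "X = (\<Sum>i=1..n. deconv_power (noise_moment D) k (y i)) - (\<Sum>i=1..n. f (x i) ^ k)"
    have eq: "m k - (\<Sum>i=1..n. g i ^ k) = X / V ^ k"
      by (simp add: X_def m_def g_def sum_mset_unlabelled power_divide diff_divide_distrib
          flip: sum_divide_distrib)
    have "\<bar>X\<bar> \<le> real n * (\<epsilon> * V ^ k)" unfolding X_def by (rule good[OF that])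
    then have "\<bar>X\<bar> / V ^ k \<le> real n * (\<epsilon> * V ^ k) / V ^ k" using V by (intro divide_right_mono) auto
    then show ?thesis unfolding eq abs_divide using V by simp
  qed
  define J where "J = (LEAST j. fits_moments V D n K \<epsilon> (unlabelled n y) j)"
  have fit: "fits_moments V D n K \<epsilon> (unlabelled n y) J"
    unfolding J_def
  proof (rule LeastI_ex)
    obtain c where c: "c \<in> grid_sequences n" "\<And>i. i \<in> {1..n} \<Longrightarrow> \<bar>g i - c i\<bar> \<le> 1 / real n"
      by (rule grid_sequences_approximate[OF g n]) simp_all
    obtain j where j: "grid_sequence n j = c"
      using from_nat_into_surj[OF countable_finite[OF finite_grid_sequences] c(1)] by blast
    have "\<bar>(\<Sum>i=1..n. c i ^ k) - m k\<bar> \<le> real n * (2 * \<epsilon>)" if k: "k \<le> K" for k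
    proof -
      have "\<bar>(\<Sum>i=1..n. c i ^ k) - (\<Sum>i=1..n. g i ^ k)\<bar> \<le> (\<Sum>i=1..n. \<bar>c i ^ k - g i ^ k\<bar>)"
        unfolding sum_subtractf[symmetric] by (rule sum_abs)
      also have "\<dots> \<le> (\<Sum>i=1..n. \<epsilon>)"
      proof (rule sum_mono)
        fix i assume i: "i \<in> {1..n}"
        have "\<bar>c i ^ k - g i ^ k\<bar> \<le> real k * \<bar>c i - g i\<bar>"
          using norm_power_diff[of "c i" "g i" k] g(2)[OF i] grid_sequence(2)[OF n i, of j] j by simp
        also have "\<dots> \<le> real K * (1 / real n)"
          using c(2)[OF i] k by (intro mult_mono) (auto simp: abs_minus_commute)
        also have "\<dots> \<le> \<epsilon>" using \<epsilon> n by (simp add: divide_le_eq mult.commute)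
        finally show "\<bar>c i ^ k - g i ^ k\<bar> \<le> \<epsilon>" .
      qed
      finally show ?thesis using m[OF k] by simp
    qed
    then show "\<exists>j. fits_moments V D n K \<epsilon> (unlabelled n y) j"
      unfolding fits_moments_def m_def j[symmetric] by blast
  qed
  have J: "\<bar>(\<Sum>i=1..n. g i ^ k) - (\<Sum>i=1..n. grid_sequence n J i ^ k)\<bar> \<le> real n * (3 * \<epsilon>)"
    if "k \<le> K" for k
  proof -
    have "\<bar>(\<Sum>i=1..n. grid_sequence n J i ^ k) - m k\<bar> \<le> real n * (2 * \<epsilon>)"
      using fit that by (simp add: fits_moments_def m_def)
    then show ?thesis using m[OF that] by linarith
  qed
  have "0 \<le> real n * \<epsilon>" using \<epsilon> by (rule order.trans[rotated]) simp
  then have \<epsilon>0: "0 \<le> \<epsilon>" using n by (simp add: zero_le_mult_iff)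
  have "(\<Sum>i=1..n. \<bar>g i - grid_sequence n J i\<bar> powr p) \<le> real n * matching_error K p (3 * \<epsilon>)"
    unfolding matching_error_def
    by (rule sum_powr_diff_le_degree[OF g(1) grid_sequence(1)[OF n] g(2) grid_sequence(2)[OF n] J _ p K])
       (use \<epsilon>0 in simp_all)
  then have le: "(\<Sum>i=1..n. \<bar>g i - grid_sequence n J i\<bar> powr p) / real n \<le> matching_error K p (3 * \<epsilon>)"
    using n by (simp add: divide_le_eq mult.commute)
  have "emp_norm_pow n x p (\<lambda>t. f t - moment_estimator V D n K \<epsilon> (unlabelled n x) (unlabelled n y) t)
      = (\<Sum>i=1..n. \<bar>f (x i) - V * grid_sequence n J i\<bar> powr p) / real n"
    by (simp add: emp_norm_pow_def moment_estimator_def rank_of_design_point[OF x] J_def)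
  also have "(\<Sum>i=1..n. \<bar>f (x i) - V * grid_sequence n J i\<bar> powr p)
      = V powr p * (\<Sum>i=1..n. \<bar>g i - grid_sequence n J i\<bar> powr p)"
  proof -
    have "f (x i) - V * grid_sequence n J i = V * (g i - grid_sequence n J i)" for i
      using V by (simp add: g_def field_simps)
    then show ?thesis using V by (simp add: abs_mult powr_mult sum_distrib_left)
  qed
  also have "\<dots> / real n = V powr p * ((\<Sum>i=1..n. \<bar>g i - grid_sequence n J i\<bar> powr p) / real n)"
    by simp
  also have "\<dots> \<le> V powr p * matching_error K p (3 * \<epsilon>)"
    by (intro mult_left_mono le) simp
  finally show ?thesis .
qed

text \<open>This covers the failure event and small sample sizes.\<close>

lemma emp_norm_moment_estimator_trivial:
  assumes V: "0 < V" and n: "1 \<le> n" and x: "design n x" and f: "f \<in> mono_class V" and p: "1 \<le> p"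
  shows "emp_norm_pow n x p (\<lambda>t. f t - moment_estimator V D n K \<epsilon> (unlabelled n x) Y t) \<le> (2 * V) powr p"
proof -
  define J where "J = (LEAST j. fits_moments V D n K \<epsilon> Y j)"
  have "emp_norm_pow n x p (\<lambda>t. f t - moment_estimator V D n K \<epsilon> (unlabelled n x) Y t)
      = (\<Sum>i=1..n. \<bar>f (x i) - V * grid_sequence n J i\<bar> powr p) / real n"
    by (simp add: emp_norm_pow_def moment_estimator_def rank_of_design_point[OF x] J_def)
  also have "\<dots> \<le> (\<Sum>i=1..n. (2 * V) powr p) / real n"
  proof (intro divide_right_mono sum_mono powr_mono2)
    fix i assume i: "i \<in> {1..n}"
    have "\<bar>f (x i)\<bar> \<le> V" using f x i by (auto simp: mono_class_def design_def)
    moreover have "\<bar>V * grid_sequence n J i\<bar> \<le> V"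
      using V grid_sequence(2)[OF n i, of J] by (simp add: abs_mult mult_left_le)
    ultimately show "\<bar>f (x i) - V * grid_sequence n J i\<bar> \<le> 2 * V" by linarith
  qed (use p in auto)
  also have "\<dots> = (2 * V) powr p" using n by simp
  finally show ?thesis .
qed

text \<open>An upper bound for the probability that some empirical moment of order at most \<open>K\<close> misses its
  target, from Chebyshev's inequality for each order and a union bound.\<close>

definition moment_failure :: "real \<Rightarrow> real \<Rightarrow> nat \<Rightarrow> nat \<Rightarrow> real \<Rightarrow> real" where
  "moment_failure V \<tau> n K \<epsilon> =
     real (K + 1) * (2 * exp (V / \<tau>) * (fact K * max 1 (4 * \<tau> / V) ^ K)\<^sup>2 / (real n * \<epsilon>\<^sup>2))"

lemma (in exp_noise) measure_moment_failure_le: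
  assumes V: "0 < V" and v: "\<And>i. i \<in> {1..n} \<Longrightarrow> \<bar>v i\<bar> \<le> V" and n: "1 \<le> n" and \<epsilon>: "0 < \<epsilon>"
  shows "measure (\<Pi>\<^sub>M i\<in>{1..n}. D) (\<Union>k\<le>K. {\<xi>\<in>space (\<Pi>\<^sub>M i\<in>{1..n}. D).
      real n * (\<epsilon> * V ^ k) \<le> \<bar>(\<Sum>i=1..n. deconv_power (noise_moment D) k (v i + \<xi> i)) - (\<Sum>i=1..n. v i ^ k)\<bar>})
    \<le> moment_failure V \<tau> n K \<epsilon>" (is "measure ?P (\<Union>k\<le>K. ?B k) \<le> _")
proof -
  interpret P: prob_space ?P by (rule prob_space_PiM) unfold_locales
  have "measure ?P (\<Union>k\<le>K. ?B k) \<le> (\<Sum>k\<le>K. measure ?P (?B k))"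
    by (rule P.finite_measure_subadditive_finite) auto
  also have "\<dots> \<le> (\<Sum>k\<le>K. 2 * exp (V / \<tau>) * (fact K * max 1 (4 * \<tau> / V) ^ K)\<^sup>2 / (real n * \<epsilon>\<^sup>2))"
  proof (rule sum_mono)
    fix k assume k: "k \<in> {..K}"
    have "measure ?P (?B k) \<le> 2 * exp (V / \<tau>) * (fact k * (4 * \<tau>) ^ k)\<^sup>2 / (real n * (\<epsilon> * V ^ k)\<^sup>2)"
      using V \<epsilon> by (intro measure_moment_error_le v n) auto
    also have "\<dots> = 2 * exp (V / \<tau>) * (fact k * (4 * \<tau> / V) ^ k)\<^sup>2 / (real n * \<epsilon>\<^sup>2)"
      using V by (simp add: power_mult_distrib power_divide)
    also have "\<dots> \<le> 2 * exp (V / \<tau>) * (fact K * max 1 (4 * \<tau> / V) ^ K)\<^sup>2 / (real n * \<epsilon>\<^sup>2)"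
    proof (intro divide_right_mono mult_left_mono power_mono mult_mono)
      have "(4 * \<tau> / V) ^ k \<le> max 1 (4 * \<tau> / V) ^ k"
        using V \<tau>_pos by (intro power_mono) auto
      also have "\<dots> \<le> max 1 (4 * \<tau> / V) ^ K"
        using k by (intro power_increasing) auto
      finally show "(4 * \<tau> / V) ^ k \<le> max 1 (4 * \<tau> / V) ^ K" .
    qed (use k V \<tau>_pos in \<open>auto intro: fact_mono\<close>)
    finally show "measure ?P (?B k)
      \<le> 2 * exp (V / \<tau>) * (fact K * max 1 (4 * \<tau> / V) ^ K)\<^sup>2 / (real n * \<epsilon>\<^sup>2)" .
  qed
  finally show ?thesis by (simp add: moment_failure_def)
qed

lemma (in exp_noise) expected_loss_moment_estimator_le:
  assumes V: "0 < V" and n: "1 \<le> n" and x: "design n x" and f: "f \<in> mono_class V" and p: "1 \<le> p"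
    and K: "4 * (nat \<lceil>p\<rceil> + 2) + 1 \<le> K" and \<epsilon>: "0 < \<epsilon>" "real K \<le> real n * \<epsilon>"
  shows "expected_loss n x D p (moment_estimator V D n K \<epsilon>) f
    \<le> ennreal (V powr p * (matching_error K p (3 * \<epsilon>) + 2 powr p * moment_failure V \<tau> n K \<epsilon>))"
proof -
  let ?P = "\<Pi>\<^sub>M i\<in>{1..n}. D"
  define B where "B = (\<Union>k\<le>K. {\<xi>\<in>space ?P. real n * (\<epsilon> * V ^ k)
      \<le> \<bar>(\<Sum>i=1..n. deconv_power (noise_moment D) k (f (x i) + \<xi> i)) - (\<Sum>i=1..n. f (x i) ^ k)\<bar>})"
  have [measurable]: "B \<in> sets ?P" unfolding B_def by measurable
  interpret P: prob_space ?P by (rule prob_space_PiM) unfold_locales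
  define E where "E = V powr p * matching_error K p (3 * \<epsilon>)"
  have E: "0 \<le> E" using \<epsilon> p by (simp add: E_def matching_error_def)
  have "expected_loss n x D p (moment_estimator V D n K \<epsilon>) f
      \<le> (\<integral>\<^sup>+\<xi>. ennreal E + ennreal ((2 * V) powr p) * indicator B \<xi> \<partial>?P)"
    unfolding expected_loss_def
  proof (rule nn_integral_mono)
    fix \<xi> assume \<xi>: "\<xi> \<in> space ?P"
    let ?l = "emp_norm_pow n x p (\<lambda>t. f t - moment_estimator V D n K \<epsilon> (unlabelled n x)
        (unlabelled n (\<lambda>i. f (x i) + \<xi> i)) t)"
    show "ennreal ?l \<le> ennreal E + ennreal ((2 * V) powr p) * indicator B \<xi>"
    proof (cases "\<xi> \<in> B")
      case True
      have "?l \<le> E + (2 * V) powr p"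
        using emp_norm_moment_estimator_trivial[OF V n x f p] E by (rule add_increasing[rotated])
      then show ?thesis using True E by (simp add: ennreal_leI flip: ennreal_plus)
    next
      case False
      then have "?l \<le> E"
        unfolding E_def using \<xi>
        by (intro emp_norm_moment_estimator_le V n x f p K \<epsilon>(2) less_imp_le) (auto simp: B_def not_le)
      then show ?thesis using False by (simp add: ennreal_leI)
    qed
  qed
  also have "\<dots> = ennreal E + ennreal ((2 * V) powr p) * emeasure ?P B"
  proof -
    have "(\<integral>\<^sup>+\<xi>. ennreal E + ennreal ((2 * V) powr p) * indicator B \<xi> \<partial>?P)
        = (\<integral>\<^sup>+\<xi>. ennreal E \<partial>?P) + (\<integral>\<^sup>+\<xi>. ennreal ((2 * V) powr p) * indicator B \<xi> \<partial>?P)"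
      by (rule nn_integral_add) measurable
    moreover have "(\<integral>\<^sup>+\<xi>. ennreal E \<partial>?P) = ennreal E"
      unfolding nn_integral_const P.emeasure_space_1 by (rule mult_1_right)
    moreover have "(\<integral>\<^sup>+\<xi>. ennreal ((2 * V) powr p) * indicator B \<xi> \<partial>?P)
        = ennreal ((2 * V) powr p) * emeasure ?P B"
      by (rule nn_integral_cmult_indicator) measurable
    ultimately show ?thesis by simp
  qed
  also have "\<dots> = ennreal E + ennreal ((2 * V) powr p * measure ?P B)"
    unfolding P.emeasure_eq_measure
    by (rule arg_cong2[where f = "(+)", OF refl ennreal_mult[symmetric]]) simp_all
  also have "\<dots> = ennreal (E + (2 * V) powr p * measure ?P B)"
    by (rule ennreal_plus[symmetric]) (use E in simp_all)
  also have "\<dots> \<le> ennreal (E + (2 * V) powr p * moment_failure V \<tau> n K \<epsilon>)"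
    unfolding B_def
  proof (intro ennreal_leI add_left_mono mult_left_mono
      measure_moment_failure_le[where v = "\<lambda>i. f (x i)"] V n \<epsilon>(1))
    show "\<bar>f (x i)\<bar> \<le> V" if "i \<in> {1..n}" for i
      using f x that by (auto simp: mono_class_def design_def)
  qed simp
  also have "E + (2 * V) powr p * moment_failure V \<tau> n K \<epsilon>
      = V powr p * (matching_error K p (3 * \<epsilon>) + 2 powr p * moment_failure V \<tau> n K \<epsilon>)"
    by (simp add: E_def powr_mult distrib_left)
  finally show ?thesis .
qed

section \<open>Tuning the degree to the sample size\<close>

text \<open>The variance of the moment estimates grows like \<open>(K!)\<^sup>2 \<le> K^(2K)\<close>, up to factors exponential in
  \<open>K\<close>. So \<open>K\<close> moments are available as long as \<open>K^K\<close> is a small power of \<open>n\<close>, that is for \<open>K\<close> of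
  order \<open>ln n / ln (ln n)\<close>, with a factor that does not depend on the noise: \<open>V\<close>, \<open>\<tau>\<close> and \<open>p\<close> only
  enter through factors at most exponential in \<open>K\<close>, which a further power \<open>K^K\<close> absorbs.\<close>

definition moment_degree :: "nat \<Rightarrow> nat" where
  "moment_degree n = nat \<lfloor>ln (real n) / (16 * ln (ln (real n)))\<rfloor>"

definition moment_tolerance :: "nat \<Rightarrow> real" where
  "moment_tolerance n = real n powr (- 1 / 4)"

lemma moment_degree_at_top: "filterlim moment_degree sequentially sequentially"
proof -
  have "filterlim (\<lambda>n. ln (real n) / (16 * ln (ln (real n)))) at_top sequentially"
    by real_asymp
  then show ?thesis
    unfolding moment_degree_def
    by (intro filterlim_compose[OF filterlim_nat_sequentially]
        filterlim_compose[OF filterlim_floor_sequentially])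
qed

lemma moment_degree_self_power:
  "eventually (\<lambda>n. real (moment_degree n) ^ (4 * moment_degree n) \<le> real n powr (1 / 4)) sequentially"
proof -
  have "eventually (\<lambda>n. 1 \<le> ln (ln (real n))) sequentially" by real_asymp
  moreover have "eventually (\<lambda>n. 1 \<le> moment_degree n) sequentially"
    using moment_degree_at_top by (simp add: filterlim_at_top)
  ultimately show ?thesis
  proof eventually_elim
    case (elim n)
    define L where "L = ln (real n)"
    define k where "k = real (moment_degree n)"
    have L: "1 \<le> ln L" "0 < L"
    proof -
      show "1 \<le> ln L" using elim by (simp add: L_def)
      show "0 < L"
      proof (rule ccontr)
        assume "\<not> 0 < L"
        then have "n = 0 \<or> n = 1"
          unfolding L_def by (metis One_nat_def Suc_lessI ln_gt_zero neq0_conv of_nat_1 of_nat_less_iff)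
        then show False using elim(1) by auto
      qed
    qed
    have n: "0 < n" using elim(1) by (cases "n = 0") auto
    have k1: "1 \<le> k" using elim by (simp add: k_def)
    have "k \<le> L / (16 * ln L)"
      using elim(2) L by (simp add: k_def moment_degree_def L_def) linarith
    moreover have "0 < 16 * ln L" using L by linarith
    ultimately have "k * (16 * ln L) \<le> L" by (simp only: pos_le_divide_eq)
    then have kL: "16 * k * ln L \<le> L" by (simp add: mult_ac)
    have "k \<le> 16 * k * ln L" using k1 L mult_mono[of 1 "ln L" k "16 * k"] by (simp add: algebra_simps)
    then have "k \<le> L" using kL by linarith
    then have "ln k \<le> ln L" using k1 L by (subst ln_le_cancel_iff) auto
    then have "4 * k * ln k \<le> 4 * k * ln L" using k1 by (intro mult_left_mono) auto
    then have "4 * k * ln k \<le> L / 4" using kL by linarith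
    then have "exp (4 * k * ln k) \<le> exp (L / 4)" by simp
    moreover have "exp (4 * k * ln k) = k powr real (4 * moment_degree n)"
      using k1 by (simp add: powr_def k_def)
    moreover have "\<dots> = k ^ (4 * moment_degree n)"
      using k1 by (intro powr_realpow) auto
    moreover have "exp (L / 4) = real n powr (1 / 4)"
      using n by (simp add: powr_def L_def)
    ultimately show ?case by (simp add: k_def)
  qed
qed

lemma inverse_moment_degree_le:
  "eventually (\<lambda>n. 1 / real (moment_degree n) \<le> 32 * (ln (ln (real n)) / ln (real n))) sequentially"
proof -
  have "eventually (\<lambda>n. 1 \<le> ln (real n) / (32 * ln (ln (real n)))) sequentially" by real_asymp
  moreover have "eventually (\<lambda>n. 0 < ln (ln (real n))) sequentially" by real_asymp
  moreover have "eventually (\<lambda>n. 0 < ln (real n)) sequentially" by real_asymp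
  ultimately show ?thesis
  proof eventually_elim
    case (elim n)
    define y where "y = ln (real n) / (32 * ln (ln (real n)))"
    have y: "1 \<le> y" using elim by (simp add: y_def)
    have "2 * y - 1 \<le> real (nat \<lfloor>2 * y\<rfloor>)" using y by linarith
    moreover have "nat \<lfloor>2 * y\<rfloor> = moment_degree n" by (simp add: moment_degree_def y_def)
    ultimately have "y \<le> real (moment_degree n)" using y by simp
    then have "1 / real (moment_degree n) \<le> 1 / y" using y by (intro divide_left_mono) auto
    also have "1 / y = 32 * (ln (ln (real n)) / ln (real n))" by (simp add: y_def)
    finally show ?case .
  qed
qed

text \<open>The moment error \<open>n^(-1/4)\<close> is at most \<open>K^(-4K)\<close>, which outweighs the coefficient norm of the
  test polynomials, since that norm is only exponential in \<open>K\<close>.\<close>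

lemma eventually_matching_error_le:
  assumes p: "1 \<le> p"
  shows "eventually (\<lambda>n. matching_error (moment_degree n) p (3 * moment_tolerance n)
    \<le> 2 * (101376 * p / real (moment_degree n)) powr p) sequentially"
proof -
  have "eventually (\<lambda>K::nat. 16 powr p * real K * real (K + 1) powr p * (real (K + 2) * (8 * 7 ^ K)) * 3 * real K powr p
      \<le> real K ^ (4 * K)) sequentially" by real_asymp
  from eventually_compose_filterlim[OF this moment_degree_at_top]
  have "eventually (\<lambda>n. 16 powr p * real (moment_degree n) * real (moment_degree n + 1) powr p
      * (real (moment_degree n + 2) * (8 * 7 ^ moment_degree n)) * 3 * real (moment_degree n) powr p
      \<le> real (moment_degree n) ^ (4 * moment_degree n)) sequentially" .
  moreover have "eventually (\<lambda>n. 1 \<le> moment_degree n) sequentially"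
    using moment_degree_at_top by (simp add: filterlim_at_top)
  ultimately show ?thesis
    using moment_degree_self_power eventually_gt_at_top[of 0]
  proof eventually_elim
    case (elim n)
    define K where "K = moment_degree n"
    define c where "c = 16 powr p * real K * real (K + 1) powr p * (real (K + 2) * (8 * 7 ^ K))"
    have "c * 3 * real K powr p \<le> real n powr (1 / 4)"
      using elim by (simp add: c_def K_def)
    then have "c * 3 * real K powr p * real n powr (- 1 / 4) \<le> real n powr (1 / 4) * real n powr (- 1 / 4)"
      by (intro mult_right_mono) auto
    also have "\<dots> = 1" using elim by (simp flip: powr_add)
    finally have "(c * (3 * moment_tolerance n)) * real K powr p \<le> 1"
      by (simp add: moment_tolerance_def algebra_simps)
    then have "c * (3 * moment_tolerance n) \<le> 1 / real K powr p"
      using elim by (simp add: K_def pos_le_divide_eq)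
    also have "\<dots> = (1 / real K) powr p" by (simp add: powr_divide)
    also have "\<dots> \<le> (101376 * p / real K) powr p"
      using p by (intro powr_mono2 divide_right_mono) auto
    finally show ?case by (simp add: matching_error_def c_def K_def)
  qed
qed

lemma eventually_moment_failure_le:
  assumes p: "1 \<le> p"
  shows "eventually (\<lambda>n. 2 powr p * moment_failure V \<tau> n (moment_degree n) (moment_tolerance n)
    \<le> (101376 * p / real (moment_degree n)) powr p) sequentially"
proof -
  define c where "c = max 2 (4 * \<tau> / V)"
  define b where "b = 2 powr p * 2 * exp (V / \<tau>)"
  have c: "1 < c" and b: "0 < b" by (auto simp: c_def b_def)
  have "eventually (\<lambda>K::nat. b * real (K + 1) * (c ^ K)\<^sup>2 * real K powr p \<le> real K ^ (2 * K)) sequentially"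
    using b c by real_asymp
  from eventually_compose_filterlim[OF this moment_degree_at_top]
  have "eventually (\<lambda>n. b * real (moment_degree n + 1) * (c ^ moment_degree n)\<^sup>2 * real (moment_degree n) powr p
      \<le> real (moment_degree n) ^ (2 * moment_degree n)) sequentially" .
  moreover have "eventually (\<lambda>n. 1 \<le> moment_degree n) sequentially"
    using moment_degree_at_top by (simp add: filterlim_at_top)
  ultimately show ?thesis
    using moment_degree_self_power eventually_gt_at_top[of 0]
  proof eventually_elim
    case (elim n)
    define K where "K = moment_degree n"
    define m where "m = max 1 (4 * \<tau> / V)"
    have K: "1 \<le> K" using elim by (simp add: K_def)
    have "(fact K :: real) \<le> real K ^ K" using fact_le_power[of K, where 'a = real] by simp
    then have f: "(fact K :: real)\<^sup>2 \<le> real K ^ (2 * K)"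
      using power_mono[of "fact K :: real" "real K ^ K" 2] by (simp add: power_mult[symmetric] mult.commute)
    have mc: "(m ^ K)\<^sup>2 \<le> (c ^ K)\<^sup>2"
      by (intro power_mono) (auto simp: m_def c_def)
    have e2: "real n * (moment_tolerance n)\<^sup>2 = real n powr (1 / 2)"
    proof -
      have "(moment_tolerance n)\<^sup>2 = real n powr (- 1 / 2)"
        by (simp add: moment_tolerance_def power2_eq_square flip: powr_add)
      then show ?thesis using elim by (simp add: powr_mult_base)
    qed
    have "b * real (K + 1) * (fact K * m ^ K)\<^sup>2 * real K powr p
        = (fact K)\<^sup>2 * (b * real (K + 1) * (m ^ K)\<^sup>2 * real K powr p)"
      by (simp add: power_mult_distrib)
    also have "\<dots> \<le> real K ^ (2 * K) * (b * real (K + 1) * (c ^ K)\<^sup>2 * real K powr p)"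
      using b f mc by (intro mult_mono) (auto intro!: mult_nonneg_nonneg)
    also have "\<dots> \<le> real K ^ (2 * K) * real K ^ (2 * K)"
      using elim by (intro mult_left_mono) (auto simp: K_def)
    also have "\<dots> = real K ^ (4 * K)" by (simp flip: power_add)
    also have "\<dots> \<le> real n powr (1 / 4)" using elim by (simp add: K_def)
    also have "\<dots> \<le> real n powr (1 / 2)" using elim by (intro powr_mono) auto
    finally have "b * real (K + 1) * (fact K * m ^ K)\<^sup>2 \<le> real n powr (1 / 2) / real K powr p"
      using K by (simp add: pos_le_divide_eq)
    then have "b * real (K + 1) * (fact K * m ^ K)\<^sup>2 / real n powr (1 / 2)
        \<le> real n powr (1 / 2) / real K powr p / real n powr (1 / 2)"
      by (intro divide_right_mono) auto
    also have "\<dots> = (1 / real K) powr p" using elim by (simp add: powr_divide)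
    also have "\<dots> \<le> (101376 * p / real K) powr p"
      using p by (intro powr_mono2 divide_right_mono) auto
    also have "b * real (K + 1) * (fact K * m ^ K)\<^sup>2 / real n powr (1 / 2)
        = 2 powr p * moment_failure V \<tau> n K (moment_tolerance n)"
      by (simp add: moment_failure_def e2 b_def m_def)
    finally show ?case by (simp add: K_def)
  qed
qed

lemma ereal_root_le:
  assumes e: "e \<le> ennreal (B powr p)" and B: "0 \<le> B" and p: "1 \<le> p"
  shows "ereal_root p e \<le> ereal B"
proof -
  have fin: "e \<noteq> \<infinity>" using e by (auto simp: top_unique)
  have "enn2real e \<le> B powr p"
    using enn2real_mono[OF e] by simp
  then have "enn2real e powr (1 / p) \<le> (B powr p) powr (1 / p)"
    using p by (intro powr_mono2) auto
  also have "\<dots> = B" using B p by (simp add: powr_powr)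
  finally show ?thesis using fin by (simp add: ereal_root_def)
qed

definition tuned_estimator :: "real \<Rightarrow> real measure \<Rightarrow> nat \<Rightarrow> estimator" where
  "tuned_estimator V D n = moment_estimator V D n (moment_degree n) (moment_tolerance n)"

lemma worst_case_risk_trivial:
  assumes D: "borel_law D" and V: "0 < V" and n: "1 \<le> n" and x: "design n x" and p: "1 \<le> p"
  shows "worst_case_risk V n x D p (tuned_estimator V D n) \<le> ereal (2 * V)"
  unfolding worst_case_risk_def
proof (rule SUP_least, rule ereal_root_le)
  fix f assume f: "f \<in> mono_class V"
  have "prob_space D" using D by (simp add: borel_law_def)
  then interpret P: prob_space "\<Pi>\<^sub>M i\<in>{1..n}. D" by (intro prob_space_PiM)
  have "expected_loss n x D p (tuned_estimator V D n) f \<le> (\<integral>\<^sup>+\<xi>. ennreal ((2 * V) powr p) \<partial>(\<Pi>\<^sub>M i\<in>{1..n}. D))"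
    unfolding expected_loss_def tuned_estimator_def
    by (intro nn_integral_mono ennreal_leI emp_norm_moment_estimator_trivial V n x f p)
  also have "\<dots> = ennreal ((2 * V) powr p)"
    unfolding nn_integral_const P.emeasure_space_1 by (rule mult_1_right)
  finally show "expected_loss n x D p (tuned_estimator V D n) f \<le> ennreal ((2 * V) powr p)" .
qed (use V p in auto)

text \<open>Both the amplified moment error and the failure probability are eventually below the main term
  \<open>(101376 p / K)^p\<close>, which gives \<open>3 \<sqdot> 101376 p V / K\<close> for the risk; the last factor \<open>32\<close> of the
  constant comes from \<open>1/K \<le> 32 ln (ln n) / ln n\<close>.\<close>

lemma eventually_worst_case_risk_le:
  assumes V: "0 < V" and p: "1 \<le> p"
  shows "eventually (\<lambda>n. \<forall>D x. exp_noise D \<tau> \<longrightarrow> design n x \<longrightarrow>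
     worst_case_risk V n x D p (tuned_estimator V D n)
       \<le> ereal (9732096 * p * V * (ln (ln (real n)) / ln (real n)))) sequentially"
proof -
  have "eventually (\<lambda>n. 4 * (nat \<lceil>p\<rceil> + 2) + 1 \<le> moment_degree n) sequentially"
    using moment_degree_at_top by (simp add: filterlim_at_top)
  then show ?thesis
    using moment_degree_self_power inverse_moment_degree_le eventually_matching_error_le[OF p]
      eventually_moment_failure_le[OF p, of V \<tau>] eventually_gt_at_top[of 0]
  proof eventually_elim
    case (elim n)
    define K where "K = moment_degree n"
    define \<epsilon> where "\<epsilon> = moment_tolerance n"
    have n: "1 \<le> n" using elim by simp
    have K: "4 * (nat \<lceil>p\<rceil> + 2) + 1 \<le> K" using elim by (simp add: K_def)
    have \<epsilon>: "0 < \<epsilon>" using n by (simp add: \<epsilon>_def moment_tolerance_def)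
    have "real K \<le> real K ^ (4 * K)" using K by (intro self_le_power) auto
    also have "\<dots> \<le> real n powr (1 / 4)" using elim by (simp add: K_def)
    also have "\<dots> \<le> real n powr (3 / 4)" using n by (intro powr_mono) auto
    also have "\<dots> = real n * \<epsilon>" using n by (simp add: \<epsilon>_def moment_tolerance_def powr_mult_base)
    finally have K\<epsilon>: "real K \<le> real n * \<epsilon>" .
    define X where "X = 101376 * p / real K"
    have X: "0 < X" using p K by (simp add: X_def)
    have "matching_error K p (3 * \<epsilon>) + 2 powr p * moment_failure V \<tau> n K \<epsilon> \<le> 3 * X powr p"
      using elim by (simp add: K_def \<epsilon>_def X_def)
    also have "\<dots> \<le> 3 powr p * X powr p"
      using p powr_mono[of 1 p 3] by (intro mult_right_mono) auto
    finally have "V powr p * (matching_error K p (3 * \<epsilon>) + 2 powr p * moment_failure V \<tau> n K \<epsilon>)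
        \<le> V powr p * (3 powr p * X powr p)"
      by (intro mult_left_mono) auto
    also have "\<dots> = (V * (3 * X)) powr p" by (simp add: powr_mult)
    finally have loss: "V powr p * (matching_error K p (3 * \<epsilon>) + 2 powr p * moment_failure V \<tau> n K \<epsilon>)
        \<le> (V * (3 * X)) powr p" .
    have "V * (3 * X) = 304128 * p * V * (1 / real K)" by (simp add: X_def)
    also have "\<dots> \<le> 304128 * p * V * (32 * (ln (ln (real n)) / ln (real n)))"
      using elim V p by (intro mult_left_mono) (auto simp: K_def)
    finally have rate: "V * (3 * X) \<le> 9732096 * p * V * (ln (ln (real n)) / ln (real n))" by simp
    show ?case
    proof (intro allI impI)
      fix D x assume D: "exp_noise D \<tau>" and x: "design n x"
      have "worst_case_risk V n x D p (tuned_estimator V D n) \<le> ereal (V * (3 * X))"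
        unfolding worst_case_risk_def
      proof (rule SUP_least, rule ereal_root_le)
        fix f assume f: "f \<in> mono_class V"
        have "expected_loss n x D p (moment_estimator V D n K \<epsilon>) f
            \<le> ennreal (V powr p * (matching_error K p (3 * \<epsilon>) + 2 powr p * moment_failure V \<tau> n K \<epsilon>))"
          by (rule exp_noise.expected_loss_moment_estimator_le[OF D V n x f p K \<epsilon> K\<epsilon>])
        also have "\<dots> \<le> ennreal ((V * (3 * X)) powr p)" by (rule ennreal_leI[OF loss])
        finally show "expected_loss n x D p (tuned_estimator V D n) f \<le> ennreal ((V * (3 * X)) powr p)"
          by (simp add: tuned_estimator_def K_def \<epsilon>_def)
      qed (use V X p in auto)
      also have "\<dots> \<le> ereal (9732096 * p * V * (ln (ln (real n)) / ln (real n)))"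
        using rate by simp
      finally show "worst_case_risk V n x D p (tuned_estimator V D n)
          \<le> ereal (9732096 * p * V * (ln (ln (real n)) / ln (real n)))" .
    qed
  qed
qed

text \<open>Adding one to the norm yields an admissible scale also if the infimum is not attained or zero,
  and keeps the scale a function of the norm alone, which makes the threshold on \<open>n\<close> uniform in
  the noise law.\<close>

lemma exp_noise_psi1_norm:
  assumes D: "borel_law D" "sub_exponential D"
  shows "exp_noise D (enn2real (psi1_norm D (\<lambda>u. u)) + 1)"
proof -
  define s where "s = psi1_norm D (\<lambda>u. u)"
  have D': "prob_space D" "sets D = sets borel" using D by (auto simp: borel_law_def)
  have s: "s < \<infinity>" using D by (simp add: s_def sub_exponential_def)
  have "s < ennreal (enn2real s + 1)"
    using s by (cases s) (auto simp: ennreal_less_iff)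
  then obtain t where t: "0 < t" "(\<integral>\<^sup>+\<omega>. ennreal (exp (\<bar>\<omega>\<bar> / t) - 1) \<partial>D) \<le> 1" "ennreal t < ennreal (enn2real s + 1)"
    unfolding s_def psi1_norm_def Inf_less_iff by auto
  have ts: "t < enn2real s + 1"
    using t(3) by (subst (asm) ennreal_less_iff) (use t(1) in auto)
  have "(\<integral>\<^sup>+\<omega>. ennreal (exp (\<bar>\<omega>\<bar> / (enn2real s + 1)) - 1) \<partial>D) \<le> (\<integral>\<^sup>+\<omega>. ennreal (exp (\<bar>\<omega>\<bar> / t) - 1) \<partial>D)"
    using ts t by (intro nn_integral_mono ennreal_leI) (auto intro!: divide_left_mono)
  also have "\<dots> \<le> 1" by (rule t)
  finally show ?thesis
    using D' by (simp add: exp_noise_def exp_noise_axioms_def s_def add_nonneg_pos)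
qed

text \<open>For small \<open>n\<close> the remainder has to turn \<open>ln (ln n) / ln n\<close> into a prescribed bound, so this
  factor must not vanish, i.e. \<open>e\<close> must not be an integer. It is negative at \<open>n = 2\<close>, which is
  harmless.\<close>

lemma ln_ln_of_nat_neq_0:
  assumes "2 \<le> (n::nat)"
  shows "ln (ln (real n)) \<noteq> 0"
proof
  assume "ln (ln (real n)) = 0"
  moreover have "0 < ln (real n)" using assms by (simp add: ln_gt_zero)
  ultimately have "ln (real n) = 1" by simp
  then have e: "exp 1 = real n" using assms by (metis exp_ln gr0I not_numeral_le_zero of_nat_0_less_iff)
  have "5 / 6 \<le> exp (- 1 / 6 :: real)" using exp_ge_add_one_self[of "- 1 / 6"] by simp
  \<comment> \<open>\<open>e \<le> (6/5)^6 < 3\<close>\<close>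
  then have "(5 / 6) ^ 6 \<le> exp (- 1 / 6 :: real) ^ 6" by (intro power_mono) auto
  also have "\<dots> = exp (- 1)" by (simp flip: exp_of_nat_mult)
  finally have "(5 / 6) ^ 6 * exp 1 \<le> exp (- 1) * exp (1::real)" by (intro mult_right_mono) auto
  moreover have "(5 / 6) ^ 6 = (15625 / 46656 :: real)" by (simp add: power_divide)
  ultimately have "15625 / 46656 * exp 1 \<le> (1::real)" by (simp flip: exp_add)
  then have "exp 1 < (3::real)" by simp
  moreover have "(5 / 2 :: real) \<le> exp 1" using exp_lower_Taylor_quadratic[of 1] by simp
  ultimately have "real n < 3" "5 / 2 \<le> real n" using e by auto
  then have "n = 2" using assms by simp
  with \<open>5 / 2 \<le> real n\<close> show False by simp
qed

text \<open>The remainder is zero from the threshold on. Before it, the remainder is defined so that the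
  claimed bound equals \<open>2 V\<close>, which holds for all sample sizes since \<open>f\<close> and the estimator have
  values in \<open>[-V, V]\<close> at the design points.\<close>

theorem theorem2:
  shows "\<exists>(C::real) (rem :: real \<Rightarrow> real \<Rightarrow> real \<Rightarrow> nat \<Rightarrow> real).
    0 < C \<and>
    (\<forall>V s p. 0 < V \<longrightarrow> 0 \<le> s \<longrightarrow> 1 \<le> p \<longrightarrow> rem V s p \<longlonglongrightarrow> 0) \<and>
    (\<forall>(V::real) (D :: real measure) (n::nat).
       0 < V \<longrightarrow> borel_law D \<longrightarrow> centered D \<longrightarrow> sub_exponential D \<longrightarrow> 2 \<le> n \<longrightarrow>
       (\<exists>est. measurable_estimator n est \<and>
         (\<forall>(p::real) x. 1 \<le> p \<longrightarrow> design n x \<longrightarrow>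
            worst_case_risk V n x D p est
              \<le> ereal (C * p * V * (ln (ln (real n)) / ln (real n))
                       * (1 + rem V (enn2real (psi1_norm D (\<lambda>u. u))) p n)))))"
proof -
  define C :: real where "C = 9732096"
  define r :: "nat \<Rightarrow> real" where "r n = ln (ln (real n)) / ln (real n)" for n
  define good where "good V s p N \<longleftrightarrow> (\<forall>n\<ge>N. \<forall>D x. exp_noise D (s + 1) \<longrightarrow> design n x \<longrightarrow>
     worst_case_risk V n x D p (tuned_estimator V D n) \<le> ereal (C * p * V * r n))" for V s p and N :: nat
  define N where "N V s p = (SOME N. good V s p N)" for V s p
  have N: "good V s p (N V s p)" if "0 < V" "1 \<le> p" for V s p
    unfolding N_def
    by (rule someI_ex)
       (use eventually_worst_case_risk_le[OF that, of "s + 1"] in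
         \<open>simp add: good_def C_def r_def eventually_sequentially\<close>)
  define rem where "rem V s p n = (if N V s p \<le> n then 0 else 2 / (C * p * r n) - 1)" for V s p n
  have "rem V s p \<longlonglongrightarrow> 0" for V s p
    by (rule tendsto_eventually)
       (auto simp: rem_def eventually_sequentially intro!: exI[of _ "N V s p"])
  moreover have "\<exists>est. measurable_estimator n est \<and>
         (\<forall>(p::real) x. 1 \<le> p \<longrightarrow> design n x \<longrightarrow>
            worst_case_risk V n x D p est
              \<le> ereal (C * p * V * r n * (1 + rem V (enn2real (psi1_norm D (\<lambda>u. u))) p n)))"
    if V: "0 < V" and D: "borel_law D" "sub_exponential D" and n: "2 \<le> n" for V D n
  proof (intro exI[of _ "tuned_estimator V D n"] conjI allI impI)
    show "measurable_estimator n (tuned_estimator V D n)"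
      unfolding tuned_estimator_def by (rule measurable_moment_estimator)
    fix p :: real and x assume p: "1 \<le> p" and x: "design n x"
    let ?s = "enn2real (psi1_norm D (\<lambda>u. u))"
    show "worst_case_risk V n x D p (tuned_estimator V D n)
        \<le> ereal (C * p * V * r n * (1 + rem V ?s p n))"
    proof (cases "N V ?s p \<le> n")
      case True
      then show ?thesis
        using N[OF V p, of ?s] exp_noise_psi1_norm[OF D] x by (simp add: good_def rem_def)
    next
      case False
      have "r n \<noteq> 0" using ln_ln_of_nat_neq_0[OF n] n by (simp add: r_def)
      then have "C * p * V * r n * (1 + rem V ?s p n) = 2 * V"
        using False p by (simp add: rem_def C_def)
      moreover have "worst_case_risk V n x D p (tuned_estimator V D n) \<le> ereal (2 * V)"
        using n by (intro worst_case_risk_trivial D V x p) simp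
      ultimately show ?thesis by (simp only:)
    qed
  qed
  ultimately show ?thesis
    by (intro exI[of _ C] exI[of _ rem]) (auto simp: C_def r_def)
qed

end
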